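(* Let $n\ge 2$ and $\varepsilon\in(0,1]$. Any algorithm that, given sample access to two unknown distributions $p,q$ over $[n]$, distinguishes with probability at least $2/3$ between $p=q$ and $|H(p)-H(q)|\ge\varepsilon$ requires \[ \tilde\Omega\!\left(\min\left\{\frac{n^{3/4}}{\varepsilon},\frac{n^{2/3}}{\varepsilon^{4/3}}\right\}\right)+\Omega\!\left(\frac{\log^2 n}{\varepsilon^2}\right) \] samples from each of $p$ and $q$.
   Context: $H(p)=\sum_x p(x)\log\frac{1}{p(x)}$ is the Shannon entropy. $\tilde\Omega(\cdot)$ hides polylogarithmic factors in its argument. *)

theory Defs
  imports "HOL-Probability.Probability"
begin

text \<open>
  Distributions over \<open>[n]\<close> are probability mass functions on \<^typ>\<open>nat\<close> supported in \<open>{1..n}\<close>.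
\<close>

definition dists :: "nat \<Rightarrow> nat pmf set" where
  "dists n = {p. set_pmf p \<subseteq> {1..n}}"

text \<open>
  Entropy is measured in bits. The base matters beyond a constant factor: for \<open>n = 2\<close> and
  \<open>\<epsilon>\<close> close to \<open>1\<close>, two entropies in nats can never differ by \<open>\<epsilon>\<close> and the testing problem would
  be void, whereas in bits the range \<open>0 < \<epsilon> \<le> 1\<close> is meaningful for every \<open>n \<ge> 2\<close>.
  Points of probability zero contribute \<open>0\<close>, as usual.
\<close>

definition shannon_entropy :: "nat \<Rightarrow> nat pmf \<Rightarrow> real" where
  "shannon_entropy n p = (\<Sum>x\<in>{1..n}. pmf p x * log 2 (1 / pmf p x))"

text \<open>
  A randomised algorithm receives \<open>m\<close> independent samples from \<open>p\<close> and \<open>m\<close> independent samples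
  from \<open>q\<close>, and returns a random verdict, \<^term>\<open>True\<close> standing for \<open>p = q\<close>. No computability
  restriction is imposed. An algorithm that draws its samples adaptively, at most \<open>m\<close> from each
  distribution, is of this form too, since it can be run on samples drawn in advance.
\<close>

definition verdict ::
  "(nat list \<Rightarrow> nat list \<Rightarrow> bool pmf) \<Rightarrow> nat \<Rightarrow> nat pmf \<Rightarrow> nat pmf \<Rightarrow> bool pmf" where
  "verdict A m p q =
     bind_pmf (replicate_pmf m p) (\<lambda>xs. bind_pmf (replicate_pmf m q) (\<lambda>ys. A xs ys))"

definition distinguishes ::
  "(nat list \<Rightarrow> nat list \<Rightarrow> bool pmf) \<Rightarrow> nat \<Rightarrow> nat \<Rightarrow> real \<Rightarrow> bool" where
  "distinguishes A m n \<epsilon> \<longleftrightarrow>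
     (\<forall>p\<in>dists n. \<forall>q\<in>dists n.
        (p = q \<longrightarrow> pmf (verdict A m p q) True \<ge> 2/3) \<and>
        (\<bar>shannon_entropy n p - shannon_entropy n q\<bar> \<ge> \<epsilon> \<longrightarrow>
           pmf (verdict A m p q) False \<ge> 2/3))"

end

theory Submission
  imports Defs "HOL-Combinatorics.Multiset_Permutations"
begin

text \<open>
  The two terms come from two hard instances; in both, the laws of the samples under the two
  hypotheses are compared in chi-square divergence, which tensorises. The logarithmic factor
  in the first term turns out to be unnecessary: the bound holds with \<open>k = 0\<close>.

  \<^item> For \<open>log\<^sup>2 n / \<epsilon>\<^sup>2\<close>, put mass \<open>7/8\<close> on one point and spread the rest evenly over the other
    points. Moving mass \<open>\<epsilon> / log n\<close> from that point to the others raises the entropy by at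
    least \<open>\<epsilon>\<close>, while the chi-square divergence is of order \<open>(\<epsilon> / log n)\<^sup>2\<close> per sample.

  \<^item> For the minimum, draw Poisson numbers of samples, so that all counts are independent, and
    group the elements into \<open>U\<close> units of \<open>s\<close> elements. Independently with probability
    \<open>\<kappa> = min (1/100) (m / U)\<close> a unit is heavy: every element has expected count \<open>1\<close> under both
    \<open>p\<close> and \<open>q\<close>. Otherwise it is light, with expected count \<open>r\<close>, of order \<open>\<epsilon> m / n\<close>, per element;
    under the alternative \<open>q\<close> concentrates the whole rate \<open>s r\<close> of the unit on one random
    element, which costs \<open>log s\<close> bits per unit of light mass. This changes the law of the
    counts only if two light samples fall into the same unit, an event of probability
    \<open>O(r\<^sup>2)\<close>, and the heavy units hide it: the divergence per unit is \<open>O(r\<^sup>4 / \<kappa>)\<close>. Hence \<open>m\<close>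
    samples do not suffice while \<open>U r\<^sup>4 / \<kappa>\<close> is small, that is, while both
    \<open>m\<^sup>4 \<epsilon>\<^sup>4 / n\<^sup>3\<close> and \<open>m\<^sup>3 \<epsilon>\<^sup>4 / n\<^sup>2\<close> are small.
\<close>

subsection \<open>Chi-square divergence\<close>

lemma integrable_measure_pmf_bounded:
  fixes f :: "'a \<Rightarrow> real"
  assumes "\<And>x. \<bar>f x\<bar> \<le> B"
  shows "integrable (measure_pmf p) f"
  by (rule measure_pmf.integrable_const_bound[where B=B]) (use assms in auto)

lemma expectation_square_le:
  fixes f :: "'a \<Rightarrow> real"
  assumes "\<And>x. \<bar>f x\<bar> \<le> B"
  shows "(measure_pmf.expectation p f)\<^sup>2 \<le> measure_pmf.expectation p (\<lambda>x. (f x)\<^sup>2)"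
proof -
  have B: "B \<ge> 0" using assms[of undefined] by linarith
  have i1: "integrable (measure_pmf p) f"
    by (rule measure_pmf.integrable_const_bound[where B=B]) (use assms in auto)
  have i2: "integrable (measure_pmf p) (\<lambda>x. (f x)\<^sup>2)"
    by (rule measure_pmf.integrable_const_bound[where B="B\<^sup>2"])
       (use assms B in \<open>auto intro!: AE_pmfI simp: abs_le_square_iff[symmetric]\<close>)
  have "0 \<le> measure_pmf.variance p f" by (rule measure_pmf.variance_positive)
  with measure_pmf.variance_eq[OF i1 i2] show ?thesis by linarith
qed

text \<open>Change of measure. The domination makes \<open>Q\<close> vanish wherever
  \<open>P\<close> does, so reading \<open>0 / 0\<close> as \<open>0\<close> loses no mass.\<close>

lemma expectation_likelihood_ratio:
  fixes f :: "'a \<Rightarrow> real"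
  assumes "\<And>x. pmf Q x \<le> B * pmf P x"
  shows "measure_pmf.expectation P (\<lambda>x. pmf Q x / pmf P x * f x) = measure_pmf.expectation Q f"
proof -
  have *: "pmf P x * (pmf Q x / pmf P x) = pmf Q x" for x
    using assms[of x] pmf_nonneg[of Q x] by (cases "pmf P x = 0") auto
  have "measure_pmf.expectation P (\<lambda>x. pmf Q x / pmf P x * f x)
      = (\<integral>x. (pmf P x * (pmf Q x / pmf P x)) * f x \<partial>count_space UNIV)"
    unfolding measure_pmf_eq_density[of P]
    by (subst integral_density) (auto simp only: mult.assoc pmf_nonneg AE_count_space real_scaleR_def
          intro!: borel_measurable_count_space)
  also have "\<dots> = measure_pmf.expectation Q f"
    unfolding * measure_pmf_eq_density[of Q]
    by (subst integral_density) (auto simp: pmf_nonneg)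
  finally show ?thesis .
qed

lemma likelihood_ratio_bound:
  assumes "pmf Q x \<le> B * pmf P x" "0 \<le> B"
  shows "0 \<le> pmf Q x / pmf P x" "pmf Q x / pmf P x \<le> B"
  using assms pmf_nonneg[of P x] pmf_nonneg[of Q x]
  by (cases "pmf P x = 0"; simp add: pos_divide_le_eq less_le)+

text \<open>With \<open>L\<close> the likelihood ratio, the difference is the
  \<open>P\<close>-expectation of \<open>(L - 1) * f\<close>. Since variances are nonnegative and
  \<open>0 \<le> f \<le> 1\<close>, its square is at most the expectation of
  \<open>(L - 1)^2\<close>, the chi-square divergence. The domination keeps \<open>L\<close>
  bounded, hence every integrand integrable.\<close>

lemma expectation_diff_le_chi_square:
  fixes f :: "'a \<Rightarrow> real"
  assumes ac: "\<And>x. pmf Q x \<le> B * pmf P x"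
    and f: "\<And>x. 0 \<le> f x" "\<And>x. f x \<le> 1"
    and chi: "measure_pmf.expectation P (\<lambda>x. (pmf Q x / pmf P x)\<^sup>2) \<le> 1 + t"
  shows "\<bar>measure_pmf.expectation Q f - measure_pmf.expectation P f\<bar> \<le> sqrt t"
proof -
  define L where "L x = pmf Q x / pmf P x" for x
  have B: "0 \<le> B" 
  proof -
    obtain x where "x \<in> set_pmf Q" using set_pmf_not_empty[of Q] by blast
    then have "0 < pmf Q x" by (simp add: pmf_positive)
    then have "0 < B * pmf P x" using ac[of x] by linarith
    then show ?thesis using pmf_nonneg[of P x] by (auto simp: zero_less_mult_iff)
  qed
  have L: "0 \<le> L x" "L x \<le> B" for x
    unfolding L_def using likelihood_ratio_bound[OF ac B] by auto
  have L2: "(L x)\<^sup>2 \<le> B\<^sup>2" for x using L[of x] B by (intro power_mono) auto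
  have Lf: "\<bar>L x * f x\<bar> \<le> B" for x
    using mult_mono[OF L(2)[of x] f(2)[of x]] L[of x] f[of x] B by simp
  have i: "integrable (measure_pmf P) L" "integrable (measure_pmf P) (\<lambda>x. (L x)\<^sup>2)"
      "integrable (measure_pmf P) (\<lambda>x. L x * f x)" "integrable (measure_pmf P) f"
    using L L2 Lf f integrable_measure_pmf_bounded[of L B P] integrable_measure_pmf_bounded[of f 1 P]
      integrable_measure_pmf_bounded[of "\<lambda>x. (L x)\<^sup>2" "B\<^sup>2" P]
      integrable_measure_pmf_bounded[of "\<lambda>x. L x * f x" B P] by auto
  have d: "\<bar>(L x - 1) * f x\<bar> \<le> B + 1" for x
  proof -
    have "\<bar>(L x - 1) * f x\<bar> \<le> \<bar>L x - 1\<bar> * 1"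
      unfolding abs_mult using f[of x] by (intro mult_left_mono) auto
    also have "\<dots> \<le> B + 1" using L[of x] B by simp
    finally show ?thesis .
  qed
  have L1: "measure_pmf.expectation P L = 1"
    using expectation_likelihood_ratio[of Q B P "\<lambda>_. 1", OF ac] by (simp add: L_def[abs_def])
  have "measure_pmf.expectation Q f - measure_pmf.expectation P f
      = measure_pmf.expectation P (\<lambda>x. (L x - 1) * f x)"
    using expectation_likelihood_ratio[of Q B P f, OF ac] i
    by (simp add: L_def[symmetric] left_diff_distrib)
  then have "(measure_pmf.expectation Q f - measure_pmf.expectation P f)\<^sup>2
      \<le> measure_pmf.expectation P (\<lambda>x. ((L x - 1) * f x)\<^sup>2)"
    using expectation_square_le[of "\<lambda>x. (L x - 1) * f x" "B + 1" P] d by simp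
  also have "\<dots> \<le> measure_pmf.expectation P (\<lambda>x. (L x)\<^sup>2 - 2 * L x + 1)"
  proof (rule integral_mono)
    show "integrable (measure_pmf P) (\<lambda>x. ((L x - 1) * f x)\<^sup>2)"
      by (rule integrable_measure_pmf_bounded[where B="(B+1)\<^sup>2"]) (use d B in \<open>auto simp: abs_le_square_iff[symmetric]\<close>)
    show "integrable (measure_pmf P) (\<lambda>x. (L x)\<^sup>2 - 2 * L x + 1)" using i by auto
    fix x
    have "((L x - 1) * f x)\<^sup>2 \<le> (L x - 1)\<^sup>2 * 1"
      unfolding power_mult_distrib using f[of x] by (intro mult_left_mono) (auto simp: power_le_one)
    then show "((L x - 1) * f x)\<^sup>2 \<le> (L x)\<^sup>2 - 2 * L x + 1" by (simp add: power2_diff)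
  qed
  also have "\<dots> = measure_pmf.expectation P (\<lambda>x. (L x)\<^sup>2) - 2 * 1 + 1"
    using i L1 by simp
  also have "\<dots> \<le> t" using chi by (simp add: L_def)
  finally have "sqrt ((measure_pmf.expectation Q f - measure_pmf.expectation P f)\<^sup>2) \<le> sqrt t"
    by (rule real_sqrt_le_mono)
  then show ?thesis by simp
qed

text \<open>Tensorisation: the likelihood ratio of the products is the product of the ratios, and by
  independence the second moments multiply. The bound \<open>t i\<close> varies with
  \<open>i\<close> so that a coordinate with equal laws can contribute the factor 1.\<close>

lemma expectation_diff_le_chi_square_Pi_pmf:
  fixes f :: "('a \<Rightarrow> 'b) \<Rightarrow> real"
  assumes I: "finite I"
    and ac: "\<And>i x. i \<in> I \<Longrightarrow> pmf (Q i) x \<le> B * pmf (P i) x"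
    and f: "\<And>x. 0 \<le> f x" "\<And>x. f x \<le> 1"
    and chi: "\<And>i. i \<in> I \<Longrightarrow>
       measure_pmf.expectation (P i) (\<lambda>x. (pmf (Q i) x / pmf (P i) x)\<^sup>2) \<le> 1 + t i"
  shows "\<bar>measure_pmf.expectation (Pi_pmf I d Q) f - measure_pmf.expectation (Pi_pmf I d P) f\<bar>
     \<le> sqrt ((\<Prod>i\<in>I. 1 + t i) - 1)"
proof (rule expectation_diff_le_chi_square)
  \<comment> \<open>Clipping at 0 gives a nonnegative constant even when \<open>I\<close> is empty,
    where the domination says nothing on the sign of \<open>B\<close>.\<close>
  define B' where "B' = max B 0"
  have ac': "pmf (Q i) x \<le> B' * pmf (P i) x" if "i \<in> I" for i x
    using ac[OF that, of x] mult_right_mono[of B B' "pmf (P i) x"] by (auto simp: B'_def)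
  show "pmf (Pi_pmf I d Q) x \<le> B' ^ card I * pmf (Pi_pmf I d P) x" for x
  proof -
    have "(\<Prod>i\<in>I. pmf (Q i) (x i)) \<le> (\<Prod>i\<in>I. B' * pmf (P i) (x i))"
      by (intro prod_mono) (auto intro: ac')
    then show ?thesis using I by (auto simp: pmf_Pi prod.distrib)
  qed
  \<comment> \<open>The factorisation is only needed on functions equal to \<open>d\<close> outside
    \<open>I\<close>, which carry all the mass.\<close>
  have "measure_pmf.expectation (Pi_pmf I d P)
          (\<lambda>x. (pmf (Pi_pmf I d Q) x / pmf (Pi_pmf I d P) x)\<^sup>2)
      = measure_pmf.expectation (Pi_pmf I d P)
          (\<lambda>x. \<Prod>i\<in>I. (pmf (Q i) (x i) / pmf (P i) (x i))\<^sup>2)"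
    using set_Pi_pmf_subset[OF I, of d P]
    by (intro integral_cong_AE) (auto simp: AE_measure_pmf_iff pmf_Pi I prod_dividef power_divide
          simp flip: prod_power_distrib)
  also have "\<dots> = (\<Prod>i\<in>I. measure_pmf.expectation (P i) (\<lambda>x. (pmf (Q i) x / pmf (P i) x)\<^sup>2))"
  proof (rule expectation_prod_Pi_pmf[OF I])
    fix i assume "i \<in> I"
    then show "integrable (measure_pmf (P i)) (\<lambda>x. (pmf (Q i) x / pmf (P i) x)\<^sup>2)"
      using likelihood_ratio_bound[OF ac'[of i]]
      by (intro measure_pmf.integrable_const_bound[where B="B'\<^sup>2"])
         (auto intro!: AE_pmfI power_mono simp: B'_def)
  qed auto
  also have "\<dots> \<le> (\<Prod>i\<in>I. 1 + t i)"
    using chi by (intro prod_mono) auto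
  finally show "measure_pmf.expectation (Pi_pmf I d P)
          (\<lambda>x. (pmf (Pi_pmf I d Q) x / pmf (Pi_pmf I d P) x)\<^sup>2) \<le> 1 + ((\<Prod>i\<in>I. 1 + t i) - 1)"
    by simp
qed (use f in auto)

text \<open>The divergence is the sum of \<open>(Q x - P x)^2 / P x\<close>; each term is at most
  \<open>t * H x\<close>, and \<open>H\<close> has total mass 1. For the collision instance
  \<open>H\<close> is the law of a heavy unit, for the two-point instance it is \<open>P\<close>
  itself.\<close>

lemma chi_square_le_dominated:
  assumes ac: "\<And>x. pmf Q x \<le> B * pmf P x"
    and t: "0 \<le> t"
    and dom: "\<And>x. (pmf Q x - pmf P x)\<^sup>2 \<le> t * pmf P x * pmf H x"
  shows "measure_pmf.expectation P (\<lambda>x. (pmf Q x / pmf P x)\<^sup>2) \<le> 1 + t"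
proof -
  define L where "L x = pmf Q x / pmf P x" for x
  define B' where "B' = max B 0"
  have ac': "pmf Q x \<le> B' * pmf P x" for x
    using ac[of x] mult_right_mono[of B B' "pmf P x"] by (auto simp: B'_def)
  have L: "0 \<le> L x" "L x \<le> B'" for x
    unfolding L_def using likelihood_ratio_bound[OF ac'] by (auto simp: B'_def)
  have L2: "(L x)\<^sup>2 \<le> B'\<^sup>2" for x using L[of x] by (intro power_mono) auto
  have i: "integrable (measure_pmf P) L" "integrable (measure_pmf P) (\<lambda>x. (L x)\<^sup>2)"
    using L L2 integrable_measure_pmf_bounded[of L B' P]
      integrable_measure_pmf_bounded[of "\<lambda>x. (L x)\<^sup>2" "B'\<^sup>2" P] by auto
  have i': "integrable (measure_pmf P) (\<lambda>x. (L x - 1)\<^sup>2)"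
    using i by (simp add: power2_diff)
  have L1: "measure_pmf.expectation P L = 1"
    using expectation_likelihood_ratio[of Q B P "\<lambda>_. 1", OF ac] by (simp add: L_def[abs_def])
  have "measure_pmf.expectation P (\<lambda>x. (L x)\<^sup>2)
      = 1 + measure_pmf.expectation P (\<lambda>x. (L x - 1)\<^sup>2)"
    using i L1 by (simp add: power2_diff)
  also have "measure_pmf.expectation P (\<lambda>x. (L x - 1)\<^sup>2)
      = (\<integral>x. pmf P x * (L x - 1)\<^sup>2 \<partial>count_space UNIV)"
    unfolding measure_pmf_eq_density[of P] by (subst integral_density) (auto simp: pmf_nonneg)
  also have "\<dots> \<le> (\<integral>x. t * pmf H x \<partial>count_space UNIV)"
  proof (rule integral_mono)
    show "integrable (count_space UNIV) (\<lambda>x. pmf P x * (L x - 1)\<^sup>2)"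
      using i' unfolding measure_pmf_eq_density[of P]
      by (subst (asm) integrable_density) (auto simp: pmf_nonneg)
    show "integrable (count_space UNIV) (\<lambda>x. t * pmf H x)" by (simp add: integrable_pmf)
    fix x
    show "pmf P x * (L x - 1)\<^sup>2 \<le> t * pmf H x"
    proof (cases "pmf P x = 0")
      case False
      then have "pmf P x * (L x - 1)\<^sup>2 = (pmf Q x - pmf P x)\<^sup>2 / pmf P x"
        by (simp add: L_def field_simps power2_eq_square)
      also have "\<dots> \<le> t * pmf H x"
        using dom[of x] False pmf_nonneg[of P x] by (simp add: divide_simps mult_ac)
      finally show ?thesis .
    next
      case True
      then show ?thesis using t by simp
    qed
  qed
  also have "\<dots> = t"
    by (simp add: integral_pmf)
  finally show ?thesis by (simp add: L_def)
qed

subsection \<open>Poissonization\<close>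

text \<open>The library specifies its Poisson distribution for positive rates only, but \<open>q\<close> avoids some elements.\<close>

definition pois :: "real \<Rightarrow> nat pmf" where
  "pois r = (if r = 0 then return_pmf 0 else poisson_pmf r)"

lemma pmf_pois: "0 \<le> r \<Longrightarrow> pmf (pois r) k = r ^ k / fact k * exp (- r)"
  by (cases k) (auto simp: pois_def)

text \<open>A list determines its length and its counts, so mixtures over either collapse to one
  term.\<close>

lemma pmf_bind_unique_preimage:
  assumes "\<And>y. y \<in> set_pmf M \<Longrightarrow> y \<noteq> y0 \<Longrightarrow> pmf (f y) x = 0"
  shows "pmf (bind_pmf M f) x = pmf M y0 * pmf (f y0) x"
  unfolding pmf_bind by (subst integral_measure_pmf_real[of "{y0}"]) (use assms in auto)

lemma pmf_replicate_pmf: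
  "pmf (replicate_pmf N p) xs = (if length xs = N then \<Prod>x\<leftarrow>xs. pmf p x else 0)"
proof (induction N arbitrary: xs)
  case 0
  then show ?case by (auto simp: indicator_def)
next
  case (Suc N)
  have "replicate_pmf (Suc N) p = map_pmf (\<lambda>(x, xs). x # xs) (pair_pmf p (replicate_pmf N p))"
    by (simp add: pair_pmf_def map_bind_pmf map_pmf_def bind_assoc_pmf bind_return_pmf)
  moreover have "inj (\<lambda>(x, xs). x # xs :: 'a list)" by (auto simp: inj_def)
  ultimately have step: "pmf (replicate_pmf (Suc N) p) (x # ys) = pmf p x * pmf (replicate_pmf N p) ys" for x :: 'a and ys
    using pmf_map_inj'[of "\<lambda>(x, xs). x # xs" "pair_pmf p (replicate_pmf N p)" "(x, ys)"]
    by (simp add: pmf_pair)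
  show ?case
  proof (cases xs)
    case Nil
    then show ?thesis by (auto simp: pmf_eq_0_set_pmf set_replicate_pmf simp del: replicate_pmf.simps)
  next
    case (Cons x ys)
    then show ?thesis using Suc.IH[of ys] Cons by (simp add: step del: replicate_pmf.simps)
  qed
qed

text \<open>Turns counts back into a list of samples by ordering them uniformly at random;
  \<open>Abs_multiset\<close> is meaningful as the counts used have finite support.\<close>

definition random_arrangement :: "('a \<Rightarrow> nat) \<Rightarrow> 'a list pmf" where
  "random_arrangement c = pmf_of_set (permutations_of_multiset (Abs_multiset c))"

text \<open>The value is the reciprocal of the multinomial coefficient that counts the
  orderings.\<close>

lemma pmf_random_arrangement:
  assumes "finite A" "\<And>x. x \<notin> A \<Longrightarrow> c x = 0"
  shows "pmf (random_arrangement c) xs =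
    (if c = count (mset xs) then (\<Prod>x\<in>A. fact (c x)) / fact (length xs) else 0)"
proof -
  have "finite {x. 0 < c x}"
    by (rule finite_subset[OF _ assms(1)]) (use assms(2) in force)
  then have c: "count (Abs_multiset c) = c" by (simp add: count_Abs_multiset)
  show ?thesis
  proof (cases "c = count (mset xs)")
    case True
    then have M: "Abs_multiset c = mset xs" using c by (metis multiset_eqI)
    have "(\<Prod>x\<in>set_mset (mset xs). fact (count (mset xs) x)) = (\<Prod>x\<in>A. fact (c x) :: nat)"
      unfolding True by (rule prod.mono_neutral_left)
        (use assms True in \<open>auto simp: not_in_iff[THEN iffD1]\<close>)
    then have "card (permutations_of_multiset (mset xs)) * (\<Prod>x\<in>A. fact (c x)) = fact (length xs)"
      using card_permutations_of_multiset_aux[of "mset xs"] by simp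
    then have "real (card (permutations_of_multiset (mset xs))) * (\<Prod>x\<in>A. fact (c x)) = fact (length xs)"
      by (metis (mono_tags, lifting) of_nat_fact of_nat_mult of_nat_prod prod.cong)
    moreover have "(\<Prod>x\<in>A. fact (c x) :: real) > 0" by (simp add: prod_pos)
    ultimately show ?thesis using True
      by (simp add: random_arrangement_def M permutations_of_multisetI field_simps)
  next
    case False
    then have "mset xs \<noteq> Abs_multiset c" using c by metis
    then show ?thesis using False
      by (auto simp: random_arrangement_def indicator_def dest: permutations_of_multisetD)
  qed
qed

text \<open>Both sides give a list \<open>xs\<close> with counts \<open>c\<close> the mass
  \<open>(\<Prod>x\<in>A. l x ^ c x) * exp (- S) / fact (length xs)\<close>: the factorials of the
  Poisson masses cancel against those of the multinomial coefficient.\<close>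

lemma Poissonization:
  assumes A: "finite A" and l: "\<And>x. x \<in> A \<Longrightarrow> 0 \<le> l x" and pos: "0 < (\<Sum>x\<in>A. l x)"
    and p: "\<And>x. pmf p x = (if x \<in> A then l x / (\<Sum>x\<in>A. l x) else 0)"
  shows "bind_pmf (Pi_pmf A 0 (\<lambda>x. pois (l x))) random_arrangement =
         bind_pmf (pois (\<Sum>x\<in>A. l x)) (\<lambda>N. replicate_pmf N p)"
proof (rule pmf_eqI)
  fix xs :: "'a list"
  define S where "S = (\<Sum>x\<in>A. l x)"
  define c where "c = count (mset xs)"
  have "pmf (bind_pmf (pois S) (\<lambda>N. replicate_pmf N p)) xs = pmf (pois S) (length xs) * (\<Prod>x\<leftarrow>xs. pmf p x)"
    by (subst pmf_bind_unique_preimage[of _ "length xs"]) (auto simp: pmf_replicate_pmf)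
  moreover have "pmf (bind_pmf (Pi_pmf A 0 (\<lambda>x. pois (l x))) random_arrangement) xs =
      pmf (Pi_pmf A 0 (\<lambda>x. pois (l x))) c * pmf (random_arrangement c) xs"
    using set_Pi_pmf_subset[OF A, of 0 "\<lambda>x. pois (l x)"]
    by (subst pmf_bind_unique_preimage[of _ c])
       (auto simp: c_def pmf_random_arrangement[OF A])
  moreover have "pmf (Pi_pmf A 0 (\<lambda>x. pois (l x))) c * pmf (random_arrangement c) xs
      = pmf (pois S) (length xs) * (\<Prod>x\<leftarrow>xs. pmf p x)"
  proof (cases "set xs \<subseteq> A")
    case False
    then obtain x where x: "x \<in> set xs" "x \<notin> A" by auto
    then have "c x \<noteq> 0" by (simp add: c_def)
    then have 0: "pmf (Pi_pmf A 0 (\<lambda>x. pois (l x))) c = 0"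
      using x A by (auto simp: pmf_Pi)
    have "(\<Prod>x\<leftarrow>xs. pmf p x) = 0"
      using x p by (auto simp: prod_list_zero_iff image_iff)
    with 0 show ?thesis by simp
  next
    case True
    have c0: "c x = 0" if "x \<notin> A" for x using that True by (auto simp: c_def count_eq_zero_iff)
    have prod: "(\<Prod>x\<leftarrow>xs. g x) = (\<Prod>x\<in>A. g x ^ c x)" for g :: "'a \<Rightarrow> real"
    proof -
      have "(\<Prod>x\<leftarrow>xs. g x) = prod_mset (image_mset g (mset xs))"
        by (metis mset_map prod_mset_prod_list)
      also have "\<dots> = (\<Prod>x\<in>set_mset (mset xs). g x ^ c x)"
        by (simp add: image_prod_mset_multiplicity c_def)
      also have "\<dots> = (\<Prod>x\<in>A. g x ^ c x)"
        using A True by (intro prod.mono_neutral_left) (auto simp: c_def not_in_iff[THEN iffD1])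
      finally show ?thesis .
    qed
    have len: "S ^ length xs = (\<Prod>x\<in>A. S ^ c x)"
      using prod[of "\<lambda>_. S"] by (simp add: map_replicate_const prod_list_replicate del: prod_constant power_sum)
    have S: "S > 0" "S \<ge> 0" using pos by (auto simp: S_def)
    have "pmf (Pi_pmf A 0 (\<lambda>x. pois (l x))) c * pmf (random_arrangement c) xs
      = (\<Prod>x\<in>A. l x ^ c x / fact (c x) * exp (- l x)) * ((\<Prod>x\<in>A. fact (c x)) / fact (length xs))"
      using A c0 l by (simp add: pmf_Pi' pmf_pois pmf_random_arrangement[OF A c0]) (simp add: c_def)
    also have "\<dots> = (\<Prod>x\<in>A. l x ^ c x) * exp (- S) / fact (length xs)"
      using A by (simp add: prod.distrib prod_dividef S_def exp_sum sum_negf[symmetric] del: sum_negf)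
    also have "(\<Prod>x\<in>A. l x ^ c x) = S ^ length xs * (\<Prod>x\<leftarrow>xs. pmf p x)"
      unfolding len prod prod.distrib[symmetric] using S p by (intro prod.cong) (auto simp: S_def power_divide)
    finally show ?thesis using S by (simp add: pmf_pois)
  qed
  ultimately show "pmf (bind_pmf (Pi_pmf A 0 (\<lambda>x. pois (l x))) random_arrangement) xs =
         pmf (bind_pmf (pois (\<Sum>x\<in>A. l x)) (\<lambda>N. replicate_pmf N p)) xs"
    by (simp add: S_def)
qed

section \<open>Counts grouped into units, and testers run on Poisson counts\<close>

definition unit_counts ::
  "'b set \<Rightarrow> ('b \<Rightarrow> real) \<times> ('b \<Rightarrow> real) \<Rightarrow> (('b \<Rightarrow> nat) \<times> ('b \<Rightarrow> nat)) pmf" where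
  "unit_counts B ab =
     pair_pmf (Pi_pmf B 0 (\<lambda>j. pois (fst ab j))) (Pi_pmf B 0 (\<lambda>j. pois (snd ab j)))"

definition merge_units ::
  "('i \<Rightarrow> ('b \<Rightarrow> nat) \<times> ('b \<Rightarrow> nat)) \<Rightarrow> ('i \<times> 'b \<Rightarrow> nat) \<times> ('i \<times> 'b \<Rightarrow> nat)" where
  "merge_units h = ((\<lambda>(u, j). fst (h u) j), (\<lambda>(u, j). snd (h u) j))"

lemma inj_merge_units: "inj merge_units"
proof (rule injI)
  fix h h' :: "'i \<Rightarrow> ('b \<Rightarrow> nat) \<times> ('b \<Rightarrow> nat)"
  assume "merge_units h = merge_units h'"
  then have "fst (h u) j = fst (h' u) j \<and> snd (h u) j = snd (h' u) j" for u j
    by (auto simp: merge_units_def fun_eq_iff)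
  then show "h = h'" by (auto simp: fun_eq_iff prod_eq_iff)
qed

text \<open>Read from right to left, this splits a product over pairs into a product over units; the
  left side has the guarded shape that \<open>pmf_Pi\<close> produces for the outer product.\<close>

lemma pmf_Pi_pmf_Pi_pmf:
  assumes "finite I" "finite B"
  shows "(if \<forall>u. u \<notin> I \<longrightarrow> (\<forall>j. f (u, j) = d) then \<Prod>u\<in>I. pmf (Pi_pmf B d (\<lambda>j. p (u, j))) (\<lambda>j. f (u, j)) else 0)
     = pmf (Pi_pmf (I \<times> B) d p) f"
proof (cases "\<forall>x. x \<notin> I \<times> B \<longrightarrow> f x = d")
  case True
  moreover from this have "pmf (Pi_pmf (I \<times> B) d p) f = (\<Prod>x\<in>I \<times> B. pmf (p x) (f x))"
    using assms by (intro pmf_Pi') auto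
  ultimately show ?thesis using assms
    by (auto simp: pmf_Pi' prod.cartesian_product)
next
  case False
  then obtain u j where uj: "(u, j) \<notin> I \<times> B" "f (u, j) \<noteq> d" by auto
  \<comment> \<open>If \<open>u\<close> lies in \<open>I\<close>, then \<open>j\<close> lies outside
    \<open>B\<close> and the factor of \<open>u\<close> vanishes; otherwise the guard fails.\<close>
  have "(\<Prod>u\<in>I. pmf (Pi_pmf B d (\<lambda>j. p (u, j))) (\<lambda>j. f (u, j))) = 0" if "u \<in> I"
    using that uj assms by (intro prod_zero) (auto intro!: bexI[of _ u] simp: pmf_Pi)
  then show ?thesis using uj assms by (auto simp: pmf_Pi)
qed

text \<open>Links the two views of the counts: the divergence tensorises over units, whereas
  Poissonization needs independent counts over single elements.\<close>

lemma merge_unit_counts: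
  assumes I: "finite I" and B: "finite B"
  shows "map_pmf merge_units (Pi_pmf I (\<lambda>_. 0, \<lambda>_. 0) (\<lambda>u. unit_counts B (\<theta> u))) =
    pair_pmf (Pi_pmf (I \<times> B) 0 (\<lambda>(u, j). pois (fst (\<theta> u) j)))
             (Pi_pmf (I \<times> B) 0 (\<lambda>(u, j). pois (snd (\<theta> u) j)))"
proof (rule pmf_eqI)
  fix fg :: "('a \<times> 'b \<Rightarrow> nat) \<times> ('a \<times> 'b \<Rightarrow> nat)"
  obtain f g where fg: "fg = (f, g)" by (cases fg)
  define h where "h = (\<lambda>u. ((\<lambda>j. f (u, j)), (\<lambda>j. g (u, j))))"
  have h: "fg = merge_units h" by (simp add: merge_units_def h_def fg)
  have z: "(\<forall>u. u \<notin> I \<longrightarrow> h u = (\<lambda>_. 0, \<lambda>_. 0)) \<longleftrightarrow>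
     (\<forall>u. u \<notin> I \<longrightarrow> (\<forall>j. f (u, j) = 0)) \<and> (\<forall>u. u \<notin> I \<longrightarrow> (\<forall>j. g (u, j) = 0))"
    by (auto simp: h_def fun_eq_iff)
  show "pmf (map_pmf merge_units (Pi_pmf I (\<lambda>_. 0, \<lambda>_. 0) (\<lambda>u. unit_counts B (\<theta> u)))) fg =
    pmf (pair_pmf (Pi_pmf (I \<times> B) 0 (\<lambda>(u, j). pois (fst (\<theta> u) j)))
             (Pi_pmf (I \<times> B) 0 (\<lambda>(u, j). pois (snd (\<theta> u) j)))) fg"
    unfolding h pmf_map_inj'[OF inj_merge_units] pmf_Pi[OF I] z
    unfolding h[symmetric] fg pmf_pair pmf_Pi_pmf_Pi_pmf[OF I B, symmetric]
    by (auto simp: unit_counts_def h_def pmf_pair prod.distrib)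
qed

text \<open>Too few samples lead to the verdict \<open>False\<close>. Acceptance thus never exceeds
  that of \<open>T\<close> on \<open>m\<close> samples, and loses only a constant factor.\<close>

definition poissonized_tester ::
  "nat \<Rightarrow> ('a list \<Rightarrow> 'a list \<Rightarrow> bool pmf) \<Rightarrow> ('a \<Rightarrow> nat) \<times> ('a \<Rightarrow> nat) \<Rightarrow> bool pmf" where
  "poissonized_tester m T fg =
     bind_pmf (random_arrangement (fst fg)) (\<lambda>xs. bind_pmf (random_arrangement (snd fg)) (\<lambda>ys.
       if m \<le> length xs \<and> m \<le> length ys then T (take m xs) (take m ys) else return_pmf False))"

lemma map_take_replicate_pmf:
  assumes "m \<le> N"
  shows "map_pmf (take m) (replicate_pmf N p) = replicate_pmf m p"
proof -
  have "replicate_pmf N p = replicate_pmf (m + (N - m)) p" using assms by simp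
  also have "map_pmf (take m) \<dots> = bind_pmf (replicate_pmf m p) (\<lambda>xs. map_pmf (\<lambda>_. xs) (replicate_pmf (N - m) p))"
    unfolding replicate_pmf_distrib map_bind_pmf map_pmf_def bind_assoc_pmf bind_return_pmf
    by (intro bind_pmf_cong refl) (auto simp: set_replicate_pmf)
  finally show ?thesis by (simp add: map_pmf_const bind_return_pmf')
qed

lemma length_replicate_pmf: "xs \<in> set_pmf (replicate_pmf N p) \<Longrightarrow> length xs = N"
  by (simp add: set_replicate_pmf)

lemma pmf_bind_threshold:
  fixes P Q :: "nat pmf"
  shows "pmf (bind_pmf P (\<lambda>N. bind_pmf Q (\<lambda>N'.
      if m \<le> N \<and> m \<le> N' then V else return_pmf False))) True =
    measure_pmf.prob P {m..} * measure_pmf.prob Q {m..} * pmf V True"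
proof -
  have "bind_pmf P (\<lambda>N. bind_pmf Q (\<lambda>N'. if m \<le> N \<and> m \<le> N' then V else return_pmf False))
      = bind_pmf (pair_pmf P Q) (\<lambda>x. if m \<le> fst x \<and> m \<le> snd x then V else return_pmf False)"
    by (simp add: pair_pmf_def bind_assoc_pmf bind_return_pmf)
  moreover have "pmf (bind_pmf (pair_pmf P Q) (\<lambda>x. if m \<le> fst x \<and> m \<le> snd x then V else return_pmf False)) True
      = measure_pmf.expectation (pair_pmf P Q) (\<lambda>x. indicator ({m..} \<times> {m..}) x * pmf V True)"
    unfolding pmf_bind by (intro Bochner_Integration.integral_cong) (auto simp: indicator_def)
  moreover have "\<dots> = measure_pmf.prob (pair_pmf P Q) ({m..} \<times> {m..}) * pmf V True"
    by simp
  ultimately show ?thesis by (simp add: measure_pmf_prob_product)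
qed

text \<open>A Chernoff bound by change of rate: the mass of rate \<open>S\<close> at
  \<open>k\<close> is \<open>2 ^ k * exp (- S / 2)\<close> times that of rate \<open>S / 2\<close>.
  For \<open>k < m\<close> this factor is at most \<open>exp (m - 8 * m)\<close>, hence at most
  \<open>exp (- 7)\<close>, below 1/8.\<close>

lemma prob_pois_ge:
  assumes S: "16 * real m \<le> S" and m: "1 \<le> m"
  shows "7/8 \<le> measure_pmf.prob (pois S) {m..}"
proof -
  have S0: "0 \<le> S" "0 \<le> S / 2" using S m by linarith+
  have le: "pmf (pois S) k \<le> 2 ^ m * exp (- S / 2) * pmf (pois (S / 2)) k" if "k < m" for k
  proof -
    have "exp (- S) = exp (- S / 2) * exp (- S / 2)" by (simp flip: exp_add)
    then have "pmf (pois S) k = 2 ^ k * exp (- S / 2) * pmf (pois (S / 2)) k"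
      using S0 by (simp add: pmf_pois power_divide)
    also have "\<dots> \<le> 2 ^ m * exp (- S / 2) * pmf (pois (S / 2)) k"
      using that by (intro mult_right_mono) auto
    finally show ?thesis .
  qed
  have "measure_pmf.prob (pois S) {..<m} = (\<Sum>k<m. pmf (pois S) k)"
    by (simp add: measure_measure_pmf_finite)
  also have "\<dots> \<le> (\<Sum>k<m. 2 ^ m * exp (- S / 2) * pmf (pois (S / 2)) k)"
    by (intro sum_mono le) auto
  also have "\<dots> = 2 ^ m * exp (- S / 2) * measure_pmf.prob (pois (S / 2)) {..<m}"
    by (simp add: measure_measure_pmf_finite sum_distrib_left)
  also have "\<dots> \<le> 2 ^ m * exp (- S / 2) * 1"
    by (intro mult_left_mono) auto
  also have "\<dots> \<le> exp 1 ^ m * exp (- (8 * real m))"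
    using exp_ge_add_one_self[of 1] S by (auto intro!: mult_mono power_mono)
  also have "\<dots> = exp (- (7 * real m))"
    by (simp flip: exp_of_nat_mult exp_add)
  also have "\<dots> \<le> exp (- 7)" using m by simp
  also have "\<dots> \<le> 1 / 8"
    using exp_ge_add_one_self[of 7] by (simp add: exp_minus field_simps)
  finally have "measure_pmf.prob (pois S) {..<m} \<le> 1 / 8" .
  moreover have "measure_pmf.prob (pois S) {m..} = 1 - measure_pmf.prob (pois S) {..<m}"
    using measure_pmf.prob_compl[of "{..<m}" "pois S"] by (simp add: Compl_eq_Diff_UNIV[symmetric] flip: not_less)
  ultimately show ?thesis by simp
qed

text \<open>After Poissonization the two sample sizes are independent Poisson numbers. If both reach
  \<open>m\<close>, the prefixes of length \<open>m\<close> are independent samples and the verdict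
  is that of \<open>V\<close>; this happens with probability at least
  \<open>(7/8)^2\<close>.\<close>

lemma pmf_poissonized_tester:
  fixes m :: nat and T :: "'a list \<Rightarrow> 'a list \<Rightarrow> bool pmf"
  assumes A: "finite A" and a: "\<And>x. x \<in> A \<Longrightarrow> 0 \<le> a x" and b: "\<And>x. x \<in> A \<Longrightarrow> 0 \<le> b x"
    and m: "1 \<le> m" and Sa: "16 * real m \<le> (\<Sum>x\<in>A. a x)" and Sb: "16 * real m \<le> (\<Sum>x\<in>A. b x)"
    and p: "\<And>x. pmf p x = (if x \<in> A then a x / (\<Sum>x\<in>A. a x) else 0)"
    and q: "\<And>x. pmf q x = (if x \<in> A then b x / (\<Sum>x\<in>A. b x) else 0)"
  defines "V \<equiv> bind_pmf (replicate_pmf m p) (\<lambda>xs. bind_pmf (replicate_pmf m q) (T xs))"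
  defines "W \<equiv> bind_pmf (pair_pmf (Pi_pmf A 0 (\<lambda>x. pois (a x))) (Pi_pmf A 0 (\<lambda>x. pois (b x))))
                 (poissonized_tester m T)"
  shows "pmf W True \<le> pmf V True" "(7/8)\<^sup>2 * pmf V True \<le> pmf W True"
proof -
  define Sa where "Sa = (\<Sum>x\<in>A. a x)"
  define Sb where "Sb = (\<Sum>x\<in>A. b x)"
  have pos: "0 < (\<Sum>x\<in>A. a x)" "0 < (\<Sum>x\<in>A. b x)" using Sa Sb m by linarith+
  let ?D = "\<lambda>xs ys. if m \<le> length xs \<and> m \<le> length ys then T (take m xs) (take m ys) else return_pmf False"
  have "W = bind_pmf (bind_pmf (Pi_pmf A 0 (\<lambda>x. pois (a x))) random_arrangement)
       (\<lambda>xs. bind_pmf (bind_pmf (Pi_pmf A 0 (\<lambda>x. pois (b x))) random_arrangement) (?D xs))"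
    unfolding W_def pair_pmf_def poissonized_tester_def bind_assoc_pmf bind_return_pmf fst_conv snd_conv
    \<comment> \<open>Swapping independent draws puts each count vector next to its own
      arrangement.\<close>
    by (subst bind_commute_pmf[of "Pi_pmf A 0 (\<lambda>x. pois (b x))"]) (rule refl)
  also have "\<dots> = bind_pmf (bind_pmf (pois Sa) (\<lambda>N. replicate_pmf N p))
       (\<lambda>xs. bind_pmf (bind_pmf (pois Sb) (\<lambda>N'. replicate_pmf N' q)) (?D xs))"
    by (simp only: Poissonization[OF A a pos(1) p] Poissonization[OF A b pos(2) q] Sa_def Sb_def)
  also have "\<dots> = bind_pmf (pois Sa) (\<lambda>N. bind_pmf (pois Sb) (\<lambda>N'. bind_pmf (replicate_pmf N p)
       (\<lambda>xs. bind_pmf (replicate_pmf N' q) (?D xs))))"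
    unfolding bind_assoc_pmf
    by (subst bind_commute_pmf[of "replicate_pmf _ p"]) (rule refl)
  also have "\<dots> = bind_pmf (pois Sa) (\<lambda>N. bind_pmf (pois Sb) (\<lambda>N'.
      if m \<le> N \<and> m \<le> N' then V else return_pmf False))"
  proof (intro bind_pmf_cong refl)
    fix N N' :: nat
    have eq: "bind_pmf (replicate_pmf N p) (\<lambda>xs. bind_pmf (replicate_pmf N' q) (?D xs)) =
       bind_pmf (replicate_pmf N p) (\<lambda>xs. bind_pmf (replicate_pmf N' q) (\<lambda>ys. 
         if m \<le> N \<and> m \<le> N' then T (take m xs) (take m ys) else return_pmf False))"
      by (intro bind_pmf_cong refl) (auto dest!: length_replicate_pmf)
    show "bind_pmf (replicate_pmf N p) (\<lambda>xs. bind_pmf (replicate_pmf N' q) (?D xs)) =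
      (if m \<le> N \<and> m \<le> N' then V else return_pmf False)"
    proof (cases "m \<le> N \<and> m \<le> N'")
      case True
      then have "V = bind_pmf (map_pmf (take m) (replicate_pmf N p))
          (\<lambda>xs. bind_pmf (map_pmf (take m) (replicate_pmf N' q)) (T xs))"
        by (simp add: V_def map_take_replicate_pmf)
      then show ?thesis unfolding eq using True by (simp add: bind_map_pmf)
    qed (auto simp: eq)
  qed
  finally have W: "pmf W True =
      measure_pmf.prob (pois Sa) {m..} * measure_pmf.prob (pois Sb) {m..} * pmf V True"
    by (simp only: pmf_bind_threshold)
  have "measure_pmf.prob (pois Sa) {m..} * measure_pmf.prob (pois Sb) {m..} \<le> 1 * 1"
    by (intro mult_mono) auto
  then show "pmf W True \<le> pmf V True"
    unfolding W using mult_right_mono[of _ 1 "pmf V True"] by simp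
  have "(7/8) * (7/8) \<le> measure_pmf.prob (pois Sa) {m..} * measure_pmf.prob (pois Sb) {m..}"
    using prob_pois_ge[OF Sa m] prob_pois_ge[OF Sb m] by (intro mult_mono) (auto simp: Sa_def Sb_def)
  then show "(7/8)\<^sup>2 * pmf V True \<le> pmf W True"
    unfolding W power2_eq_square by (rule mult_right_mono) simp
qed

subsection \<open>The collision instance\<close>

definition unit_state :: "real \<Rightarrow> nat \<Rightarrow> nat option pmf" where
  "unit_state \<kappa> s =
     bind_pmf (bernoulli_pmf \<kappa>) (\<lambda>b. if b then return_pmf None else map_pmf Some (pmf_of_set {..<s}))"

text \<open>
  The state of a unit is \<open>None\<close> if it is heavy and \<open>Some j\<close> if it is light; \<open>j\<close> is the element on
  which \<open>q\<close> concentrates under the alternative. The pairs are the rates of \<open>p\<close> and \<open>q\<close>.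
\<close>

definition null_rates :: "real \<Rightarrow> nat option \<Rightarrow> (nat \<Rightarrow> real) \<times> (nat \<Rightarrow> real)" where
  "null_rates r st = (case st of None \<Rightarrow> (\<lambda>_. 1, \<lambda>_. 1) | Some j \<Rightarrow> (\<lambda>_. r, \<lambda>_. r))"

definition alt_rates :: "nat \<Rightarrow> real \<Rightarrow> nat option \<Rightarrow> (nat \<Rightarrow> real) \<times> (nat \<Rightarrow> real)" where
  "alt_rates s r st = (case st of None \<Rightarrow> (\<lambda>_. 1, \<lambda>_. 1)
     | Some j \<Rightarrow> (\<lambda>_. r, \<lambda>i. if i = j then real s * r else 0))"

lemma pmf_bind_unit_state:
  assumes "0 \<le> \<kappa>" "\<kappa> \<le> 1" "0 < s"
  shows "pmf (bind_pmf (unit_state \<kappa> s) F) x =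
    \<kappa> * pmf (F None) x + (1 - \<kappa>) * ((\<Sum>j<s. pmf (F (Some j)) x) / real s)"
proof -
  have ne: "{..<s} \<noteq> {}" using assms(3) by auto
  have "bind_pmf (unit_state \<kappa> s) F =
    bind_pmf (bernoulli_pmf \<kappa>) (\<lambda>b. if b then F None else bind_pmf (pmf_of_set {..<s}) (\<lambda>j. F (Some j)))"
    unfolding unit_state_def bind_assoc_pmf
    by (intro bind_pmf_cong refl) (auto simp: bind_return_pmf bind_map_pmf)
  then show ?thesis
    using assms by (simp add: pmf_bind[of "bernoulli_pmf \<kappa>"] pmf_bind_pmf_of_set[OF ne] mult.commute)
qed

text \<open>Vanishing rates are covered through \<open>0 ^ 0 = 1\<close>.\<close>

lemma pmf_unit_counts:
  fixes a b :: "nat \<Rightarrow> real"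
  assumes "\<And>j. 0 \<le> a j" "\<And>j. 0 \<le> b j"
  shows "pmf (unit_counts {..<s} (a, b)) (f, g) =
    (if (\<forall>j. j \<notin> {..<s} \<longrightarrow> f j = 0) \<and> (\<forall>j. j \<notin> {..<s} \<longrightarrow> g j = 0)
     then (\<Prod>j<s. a j ^ f j) * (\<Prod>j<s. b j ^ g j) * exp (- (\<Sum>j<s. a j + b j))
       / ((\<Prod>j<s. fact (f j)) * (\<Prod>j<s. fact (g j))) else 0)"
  using assms
  by (auto simp: unit_counts_def pmf_pair pmf_Pi pmf_pois prod.distrib prod_dividef exp_sum[symmetric]
      sum_negf sum.distrib exp_add[symmetric])

text \<open>
  Moving the whole rate of \<open>s\<close> elements to a random one of them leaves the law of the
  counts unchanged as long as at most one sample is seen; a discrepancy needs a collision.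
\<close>

lemma collision_discrepancy:
  fixes g :: "nat \<Rightarrow> nat"
  assumes s: "0 < s" and r: "0 \<le> r" and sr: "real s * r \<le> 1"
  shows "\<bar>(\<Sum>j<s. \<Prod>i<s. (if i = j then real s * r else 0) ^ g i) / real s - r ^ (\<Sum>i<s. g i)\<bar>
    \<le> (real s * r)\<^sup>2"
proof -
  define n where "n = (\<Sum>i<s. g i)"
  \<comment> \<open>The product is nonzero only if all \<open>n\<close> samples of the unit fall on
    the element \<open>j\<close>.\<close>
  define t where "t j = (if n = g j then (real s * r) ^ n else 0)" for j
  have gn: "g j \<le> n" if "j < s" for j
    unfolding n_def using that by (intro member_le_sum) auto
  have t: "(\<Prod>i<s. (if i = j then real s * r else 0) ^ g i) = t j" if "j < s" for j
  proof -
    have "(\<Prod>i<s. (if i = j then real s * r else 0) ^ g i)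
        = (real s * r) ^ g j * (\<Prod>i\<in>{..<s} - {j}. (if i = j then real s * r else 0) ^ g i)"
      using that by (subst prod.remove[of _ j]) auto
    also have "(\<Prod>i\<in>{..<s} - {j}. (if i = j then real s * r else 0) ^ g i)
        = (\<Prod>i\<in>{..<s} - {j}. 0 ^ g i)"
      by (intro prod.cong) auto
    also have "\<dots> = (0 :: real) ^ (\<Sum>i\<in>{..<s} - {j}. g i)" by (simp add: power_sum)
    also have "(\<Sum>i\<in>{..<s} - {j}. g i) = n - g j"
      using that unfolding n_def by (subst sum.remove[of "{..<s}" j]) auto
    finally show ?thesis using gn[OF that] by (auto simp: t_def power_0_left)
  qed
  have "\<bar>(\<Sum>j<s. t j) / real s - r ^ n\<bar> \<le> (real s * r)\<^sup>2"
  proof -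
    \<comment> \<open>Without samples both terms are 1; with one sample the average is
      \<open>s * r / s = r\<close>; from two samples on, both terms lie between 0 and
      \<open>(s * r)^2\<close>, as \<open>s \<ge> 1\<close> and
      \<open>s * r \<le> 1\<close>.\<close>
    consider "n = 0" | "n = 1" | "2 \<le> n" by linarith
    then show ?thesis
    proof cases
      case 1
      then have "(\<Sum>j<s. t j) = (\<Sum>j<s. 1)" using gn by (intro sum.cong) (auto simp: t_def)
      then show ?thesis using 1 s by simp
    next
      case 2
      have "(\<Sum>j<s. t j) = (\<Sum>j<s. real (g j) * (real s * r))"
      proof (intro sum.cong refl)
        fix j assume "j \<in> {..<s}"
        then have "g j \<le> 1" using gn[of j] 2 by simp
        then consider "g j = 0" | "g j = 1" by linarith
        then show "t j = real (g j) * (real s * r)" by cases (simp_all add: t_def 2)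
      qed
      also have "\<dots> = real n * (real s * r)" by (simp add: n_def sum_distrib_right)
      finally show ?thesis using 2 s by simp
    next
      case 3
      have sr0: "0 \<le> real s * r" using r by simp
      have pw: "(real s * r) ^ n \<le> (real s * r)\<^sup>2" using 3 sr sr0 by (intro power_decreasing) auto
      have "0 \<le> t j" "t j \<le> (real s * r)\<^sup>2" for j using pw sr0 by (auto simp: t_def)
      then have "0 \<le> (\<Sum>j<s. t j)" "(\<Sum>j<s. t j) \<le> (\<Sum>j<s. (real s * r)\<^sup>2)"
        using sum_mono[of "{..<s}" t "\<lambda>_. (real s * r)\<^sup>2"] by (auto intro!: sum_nonneg)
      then have "0 \<le> (\<Sum>j<s. t j) / real s" "(\<Sum>j<s. t j) / real s \<le> (real s * r)\<^sup>2"
        using s by (auto simp: divide_simps mult.commute)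
      moreover have "0 \<le> r ^ n" "r ^ n \<le> (real s * r) ^ n"
        using r s by (auto intro!: power_mono simp: mult_le_cancel_right1)
      ultimately show ?thesis using pw by linarith
    qed
  qed
  then show ?thesis using t by (simp add: n_def)
qed

text \<open>The discrepancy is a common factor \<open>p\<close> times the collision discrepancy of
  the counts \<open>g\<close> of \<open>q\<close>. The law of a heavy unit has the same factorials
  in its denominator, so it dominates \<open>p\<close> up to \<open>exp (2 * s)\<close>.\<close>

lemma light_unit_discrepancy:
  assumes s: "0 < s" and r: "0 \<le> r" and sr: "real s * r \<le> 1"
  shows "\<bar>(\<Sum>j<s. pmf (unit_counts {..<s} (alt_rates s r (Some j))) x) / real s
      - (\<Sum>j<s. pmf (unit_counts {..<s} (null_rates r (Some j))) x) / real s\<bar>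
    \<le> exp (2 * real s) * (real s * r)\<^sup>2 * pmf (unit_counts {..<s} (\<lambda>_. 1, \<lambda>_. 1)) x"
proof -
  obtain f g where x: "x = (f, g)" by (cases x)
  show ?thesis
  proof (cases "(\<forall>j. j \<notin> {..<s} \<longrightarrow> f j = 0) \<and> (\<forall>j. j \<notin> {..<s} \<longrightarrow> g j = 0)")
    case False
    have "pmf (unit_counts {..<s} (a, b)) x = 0" if "\<And>j. 0 \<le> a j" "\<And>j. 0 \<le> b j" for a b
      unfolding x using that by (subst pmf_unit_counts) (use False in auto)
    then show ?thesis using r by (simp add: null_rates_def alt_rates_def)
  next
    case True
    define F where "F = (\<Prod>j<s. fact (f j) :: real) * (\<Prod>j<s. fact (g j))"
    have F: "F > 0" by (simp add: F_def prod_pos)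
    have pmf: "pmf (unit_counts {..<s} (a, b)) x =
        (\<Prod>j<s. a j ^ f j) * (\<Prod>j<s. b j ^ g j) * exp (- (\<Sum>j<s. a j + b j)) / F"
      if "\<And>j. 0 \<le> a j" "\<And>j. 0 \<le> b j" for a b
      unfolding x F_def using that by (subst pmf_unit_counts) (use True in auto)
    \<comment> \<open>The shared factor: the counts \<open>f\<close> of \<open>p\<close> have the
      same rates in both cases, and the rates of a light unit sum to \<open>2 * (s * r)\<close> in
      both.\<close>
    define p where "p = r ^ (\<Sum>j<s. f j) * exp (- (2 * (real s * r))) / F"
    define D where "D = (\<Sum>j<s. \<Prod>i<s. (if i = j then real s * r else 0) ^ g i) / real s - r ^ (\<Sum>i<s. g i)"
    have H: "pmf (unit_counts {..<s} (\<lambda>_. 1, \<lambda>_. 1)) x = exp (- (2 * real s)) / F"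
      by (simp add: pmf mult.commute)
    have N: "pmf (unit_counts {..<s} (null_rates r (Some j))) x = p * r ^ (\<Sum>i<s. g i)" for j
      using r by (simp add: null_rates_def pmf p_def power_sum[symmetric] mult_ac)
    have A: "pmf (unit_counts {..<s} (alt_rates s r (Some j))) x
        = p * (\<Prod>i<s. (if i = j then real s * r else 0) ^ g i)" if "j < s" for j
    proof -
      have "(\<Sum>i<s. r + (if i = j then real s * r else 0)) = 2 * (real s * r)"
        using that by (simp add: sum.distrib)
      then show ?thesis
        using r by (simp add: alt_rates_def pmf p_def power_sum[symmetric] mult_ac)
    qed
    have r1: "r \<le> 1"
    proof -
      have "1 * r \<le> real s * r" using s r by (intro mult_right_mono) auto
      then show ?thesis using sr by simp
    qed
    have p: "0 \<le> p" "p \<le> exp (2 * real s) * (exp (- (2 * real s)) / F)"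
    proof -
      show "0 \<le> p" using r F by (simp add: p_def)
      have "r ^ (\<Sum>j<s. f j) * exp (- (2 * (real s * r))) \<le> 1 * 1"
        using r r1 by (intro mult_mono) (auto simp: power_le_one)
      then have "p \<le> 1 / F" unfolding p_def using F by (intro divide_right_mono) auto
      then show "p \<le> exp (2 * real s) * (exp (- (2 * real s)) / F)" by (simp flip: exp_add)
    qed
    have "(\<Sum>j<s. pmf (unit_counts {..<s} (alt_rates s r (Some j))) x) / real s
      - (\<Sum>j<s. pmf (unit_counts {..<s} (null_rates r (Some j))) x) / real s = p * D"
      using s by (simp add: A N D_def sum_distrib_left[symmetric] right_diff_distrib)
    then have "\<bar>(\<Sum>j<s. pmf (unit_counts {..<s} (alt_rates s r (Some j))) x) / real s
      - (\<Sum>j<s. pmf (unit_counts {..<s} (null_rates r (Some j))) x) / real s\<bar> = p * \<bar>D\<bar>"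
      using p by (simp add: abs_mult)
    also have "\<dots> \<le> exp (2 * real s) * (exp (- (2 * real s)) / F) * (real s * r)\<^sup>2"
      using p collision_discrepancy[OF s r sr] by (intro mult_mono) (auto simp: D_def)
    finally show ?thesis by (simp add: H mult_ac)
  qed
qed

text \<open>Both mixtures contain the heavy law \<open>H\<close> with weight
  \<open>\<kappa>\<close>, so \<open>\<kappa> * H \<le> P\<close>, while
  \<open>\<bar>Q - P\<bar> \<le> K * H\<close>. Therefore
  \<open>(Q - P)^2 \<le> K^2 * H * H \<le> K^2 / \<kappa> * P * H\<close>.\<close>

lemma unit_chi_square:
  fixes \<kappa> r :: real and s :: nat
  assumes \<kappa>: "0 < \<kappa>" "\<kappa> \<le> 1" and s: "0 < s" and r: "0 \<le> r" and sr: "real s * r \<le> 1"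
  defines "P \<equiv> bind_pmf (unit_state \<kappa> s) (\<lambda>st. unit_counts {..<s} (null_rates r st))"
  defines "Q \<equiv> bind_pmf (unit_state \<kappa> s) (\<lambda>st. unit_counts {..<s} (alt_rates s r st))"
  defines "K \<equiv> exp (2 * real s) * (real s * r)\<^sup>2"
  shows "pmf Q x \<le> (1 + K / \<kappa>) * pmf P x"
    and "measure_pmf.expectation P (\<lambda>x. (pmf Q x / pmf P x)\<^sup>2) \<le> 1 + K\<^sup>2 / \<kappa>"
proof -
  define H where "H = unit_counts {..<s} (\<lambda>_. 1, \<lambda>_. 1)"
  define a where "a x = (\<Sum>j<s. pmf (unit_counts {..<s} (alt_rates s r (Some j))) x) / real s" for x
  define b where "b x = (\<Sum>j<s. pmf (unit_counts {..<s} (null_rates r (Some j))) x) / real s" for x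
  have P: "pmf P x = \<kappa> * pmf H x + (1 - \<kappa>) * b x" for x
    unfolding P_def using \<kappa> s by (subst pmf_bind_unit_state) (auto simp: null_rates_def H_def b_def)
  have Q: "pmf Q x = \<kappa> * pmf H x + (1 - \<kappa>) * a x" for x
    unfolding Q_def using \<kappa> s by (subst pmf_bind_unit_state) (auto simp: alt_rates_def H_def a_def)
  have K: "0 \<le> K" by (simp add: K_def)
  have ab: "\<bar>a x - b x\<bar> \<le> K * pmf H x" for x
    unfolding a_def b_def K_def H_def by (rule light_unit_discrepancy[OF s r sr])
  have diff: "\<bar>pmf Q x - pmf P x\<bar> \<le> K * pmf H x" for x
  proof -
    have "\<bar>pmf Q x - pmf P x\<bar> = (1 - \<kappa>) * \<bar>a x - b x\<bar>"
    proof -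
      have "pmf Q x - pmf P x = (1 - \<kappa>) * (a x - b x)" unfolding P Q by (simp only: right_diff_distrib)
      then show ?thesis using \<kappa> by (simp add: abs_mult)
    qed
    also have "\<dots> \<le> 1 * (K * pmf H x)" using \<kappa> ab[of x] by (intro mult_mono) auto
    finally show ?thesis by simp
  qed
  have HP: "pmf H x \<le> pmf P x / \<kappa>" for x
  proof -
    have "0 \<le> b x" by (auto simp: b_def intro!: divide_nonneg_nonneg sum_nonneg)
    then have "0 \<le> (1 - \<kappa>) * b x" using \<kappa> by simp
    then show ?thesis using \<kappa> by (simp add: P pos_le_divide_eq mult.commute)
  qed
  have dom: "pmf Q x \<le> (1 + K / \<kappa>) * pmf P x" for x
  proof -
    have "pmf Q x \<le> pmf P x + K * pmf H x" using diff[of x] by linarith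
    also have "\<dots> \<le> pmf P x + K * (pmf P x / \<kappa>)" using HP K by (intro add_left_mono mult_left_mono) auto
    finally show ?thesis by (simp add: distrib_right)
  qed
  then show "pmf Q x \<le> (1 + K / \<kappa>) * pmf P x" .
  show "measure_pmf.expectation P (\<lambda>x. (pmf Q x / pmf P x)\<^sup>2) \<le> 1 + K\<^sup>2 / \<kappa>"
  proof (rule chi_square_le_dominated[OF dom])
    show "0 \<le> K\<^sup>2 / \<kappa>" using \<kappa> by simp
    fix x
    have "(pmf Q x - pmf P x)\<^sup>2 \<le> (K * pmf H x)\<^sup>2"
      by (rule power2_le_iff_abs_le[THEN iffD2]) (use diff[of x] K in auto)
    also have "\<dots> = K\<^sup>2 * pmf H x * pmf H x" by (simp add: power2_eq_square mult_ac)
    also have "\<dots> \<le> K\<^sup>2 * (pmf P x / \<kappa>) * pmf H x"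
      using HP by (intro mult_right_mono mult_left_mono) auto
    finally show "(pmf Q x - pmf P x)\<^sup>2 \<le> K\<^sup>2 / \<kappa> * pmf P x * pmf H x" by simp
  qed
qed

section \<open>Relabelling of supports; rates and entropies of the collision instance\<close>

lemma replicate_pmf_map_pmf: "replicate_pmf m (map_pmf f p) = map_pmf (map f) (replicate_pmf m p)"
  by (induction m) (simp_all add: map_pmf_def bind_assoc_pmf bind_return_pmf)

lemma verdict_map_pmf:
  "verdict A m (map_pmf \<iota> p) (map_pmf \<iota> q) =
   bind_pmf (replicate_pmf m p) (\<lambda>xs. bind_pmf (replicate_pmf m q) (\<lambda>ys. A (map \<iota> xs) (map \<iota> ys)))"
  by (simp add: verdict_def replicate_pmf_map_pmf bind_map_pmf)

lemma shannon_entropy_map_pmf: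
  assumes S: "finite S" "set_pmf p \<subseteq> S" "inj_on \<iota> S" "\<iota> ` S \<subseteq> {1..n}"
  shows "shannon_entropy n (map_pmf \<iota> p) = (\<Sum>x\<in>S. pmf p x * log 2 (1 / pmf p x))"
proof -
  have pmf: "pmf (map_pmf \<iota> p) (\<iota> x) = pmf p x" if "x \<in> S" for x
  proof (cases "x \<in> set_pmf p")
    case True
    then show ?thesis using S by (intro pmf_map_inj) (auto intro: inj_on_subset)
  next
    case False
    then have "\<iota> x \<notin> set_pmf (map_pmf \<iota> p)"
      using S that by (auto dest: inj_onD)
    then show ?thesis using False by (metis pmf_eq_0_set_pmf)
  qed
  have "shannon_entropy n (map_pmf \<iota> p) =
      (\<Sum>y\<in>\<iota> ` S. pmf (map_pmf \<iota> p) y * log 2 (1 / pmf (map_pmf \<iota> p) y))"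
    unfolding shannon_entropy_def
  proof (rule sum.mono_neutral_right)
    show "\<forall>i\<in>{1..n} - \<iota> ` S. pmf (map_pmf \<iota> p) i * log 2 (1 / pmf (map_pmf \<iota> p) i) = 0"
    proof
      fix i assume "i \<in> {1..n} - \<iota> ` S"
      then have "i \<notin> set_pmf (map_pmf \<iota> p)" using S by auto
      then show "pmf (map_pmf \<iota> p) i * log 2 (1 / pmf (map_pmf \<iota> p) i) = 0"
        by (simp add: pmf_eq_0_set_pmf)
    qed
  qed (use S in auto)
  also have "\<dots> = (\<Sum>x\<in>S. pmf p x * log 2 (1 / pmf p x))"
    using S by (subst sum.reindex) (auto intro!: sum.cong simp: pmf)
  finally show ?thesis .
qed

lemma map_pmf_in_dists:
  assumes "set_pmf p \<subseteq> S" "\<iota> ` S \<subseteq> {1..n}"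
  shows "map_pmf \<iota> p \<in> dists n"
  using assms by (auto simp: dists_def)

lemma normalized_pmf:
  fixes l :: "'a \<Rightarrow> real"
  assumes A: "finite A" and l: "\<And>x. x \<in> A \<Longrightarrow> 0 \<le> l x" and pos: "0 < (\<Sum>x\<in>A. l x)"
  obtains p where "\<And>x. pmf p x = (if x \<in> A then l x / (\<Sum>x\<in>A. l x) else 0)" "set_pmf p \<subseteq> A"
proof -
  define f where "f x = (if x \<in> A then l x / (\<Sum>x\<in>A. l x) else 0)" for x
  have nonneg: "0 \<le> f x" for x using l pos by (simp add: f_def)
  have "(\<integral>\<^sup>+x. ennreal (f x) \<partial>count_space UNIV) = (\<Sum>x\<in>A. ennreal (f x))"
    using A by (intro nn_integral_count_space') (auto simp: f_def)
  also have "\<dots> = ennreal (\<Sum>x\<in>A. f x)" using nonneg by simp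
  also have "(\<Sum>x\<in>A. f x) = 1" using pos by (simp add: f_def flip: sum_divide_distrib)
  finally have pmf: "pmf (embed_pmf f) x = f x" for x
    using nonneg by (intro pmf_embed_pmf) auto
  then have "set_pmf (embed_pmf f) \<subseteq> A" by (auto simp: set_pmf_eq f_def)
  then show thesis using that[of "embed_pmf f"] pmf by (simp add: f_def)
qed

text \<open>
  Unit \<open>U\<close> is a reserve with known rate \<open>\<mu>\<close>; it makes the expected number of samples exceed \<open>m\<close>.
\<close>

definition rates :: "nat \<Rightarrow> real \<Rightarrow> (nat option \<Rightarrow> (nat \<Rightarrow> real) \<times> (nat \<Rightarrow> real)) \<Rightarrow>
    (nat \<Rightarrow> nat option) \<Rightarrow> nat \<Rightarrow> (nat \<Rightarrow> real) \<times> (nat \<Rightarrow> real)" where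
  "rates U \<mu> R \<omega> u = (if u < U then R (\<omega> u) else (\<lambda>_. \<mu>, \<lambda>_. \<mu>))"

definition total_rate :: "nat \<Rightarrow> nat \<Rightarrow> real \<Rightarrow> real \<Rightarrow> (nat \<Rightarrow> nat option) \<Rightarrow> real" where
  "total_rate s U \<mu> r \<omega> = real s * \<mu> + (\<Sum>u<U. if \<omega> u = None then real s else real s * r)"

lemma sum_units:
  fixes f :: "'b \<Rightarrow> real" and F :: "nat \<Rightarrow> 'c \<Rightarrow> 'b"
  shows "(\<Sum>(u, j)\<in>{..U} \<times> J. f (F u j)) = (\<Sum>j\<in>J. f (F U j)) + (\<Sum>u<U. \<Sum>j\<in>J. f (F u j))"
  by (simp add: sum.cartesian_product[symmetric] lessThan_Suc_atMost[symmetric])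

text \<open>A concentrated unit keeps its total \<open>s * r\<close>. Hence \<open>p\<close> and
  \<open>q\<close> share one normalising constant under both hypotheses, and it depends only on
  which units are heavy.\<close>

lemma sum_rates:
  assumes \<omega>: "\<And>u. u < U \<Longrightarrow> \<omega> u \<in> insert None (Some ` {..<s})"
  shows "(\<Sum>(u, j)\<in>{..U} \<times> {..<s}. fst (rates U \<mu> (null_rates r) \<omega> u) j) = total_rate s U \<mu> r \<omega>"
    and "(\<Sum>(u, j)\<in>{..U} \<times> {..<s}. snd (rates U \<mu> (null_rates r) \<omega> u) j) = total_rate s U \<mu> r \<omega>"
    and "(\<Sum>(u, j)\<in>{..U} \<times> {..<s}. fst (rates U \<mu> (alt_rates s r) \<omega> u) j) = total_rate s U \<mu> r \<omega>"
    and "(\<Sum>(u, j)\<in>{..U} \<times> {..<s}. snd (rates U \<mu> (alt_rates s r) \<omega> u) j) = total_rate s U \<mu> r \<omega>"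
proof -
  have unit: "(\<Sum>j<s. fst (null_rates r (\<omega> u)) j) = (if \<omega> u = None then real s else real s * r)"
    "(\<Sum>j<s. snd (null_rates r (\<omega> u)) j) = (if \<omega> u = None then real s else real s * r)"
    "(\<Sum>j<s. fst (alt_rates s r (\<omega> u)) j) = (if \<omega> u = None then real s else real s * r)"
    "(\<Sum>j<s. snd (alt_rates s r (\<omega> u)) j) = (if \<omega> u = None then real s else real s * r)"
    if "u < U" for u
    using \<omega>[OF that] by (auto simp: null_rates_def alt_rates_def)
  show "(\<Sum>(u, j)\<in>{..U} \<times> {..<s}. fst (rates U \<mu> (null_rates r) \<omega> u) j) = total_rate s U \<mu> r \<omega>"
    "(\<Sum>(u, j)\<in>{..U} \<times> {..<s}. snd (rates U \<mu> (null_rates r) \<omega> u) j) = total_rate s U \<mu> r \<omega>"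
    "(\<Sum>(u, j)\<in>{..U} \<times> {..<s}. fst (rates U \<mu> (alt_rates s r) \<omega> u) j) = total_rate s U \<mu> r \<omega>"
    "(\<Sum>(u, j)\<in>{..U} \<times> {..<s}. snd (rates U \<mu> (alt_rates s r) \<omega> u) j) = total_rate s U \<mu> r \<omega>"
    by (simp_all add: sum_units[of "\<lambda>x. x"] rates_def total_rate_def unit)
qed

text \<open>Heavy units and the reserve have equal rates under \<open>p\<close> and \<open>q\<close>
  and cancel. A light unit has mass \<open>s * r / S\<close> under both; spreading it evenly over
  \<open>s\<close> elements instead of one adds \<open>log 2 s\<close> bits per unit of
  mass.\<close>

lemma entropy_gap:
  assumes \<omega>: "\<And>u. u < U \<Longrightarrow> \<omega> u \<in> insert None (Some ` {..<s})"
    and s: "0 < s" and r: "0 < r" and S: "0 < S"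
  defines "\<phi> \<equiv> \<lambda>y::real. y / S * log 2 (1 / (y / S))"
  shows "(\<Sum>(u, j)\<in>{..U} \<times> {..<s}. \<phi> (fst (rates U \<mu> (alt_rates s r) \<omega> u) j))
       - (\<Sum>(u, j)\<in>{..U} \<times> {..<s}. \<phi> (snd (rates U \<mu> (alt_rates s r) \<omega> u) j))
    = real (card {u\<in>{..<U}. \<omega> u \<noteq> None}) * (real s * r / S * log 2 (real s))"
proof -
  have unit: "(\<Sum>j<s. \<phi> (fst (alt_rates s r st) j)) - (\<Sum>j<s. \<phi> (snd (alt_rates s r st) j))
      = (if st = None then 0 else real s * r / S * log 2 (real s))"
    if st: "st \<in> insert None (Some ` {..<s})" for st
  proof (cases st)
    case None
    then show ?thesis by (simp add: alt_rates_def)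
  next
    case (Some j)
    then have j: "j < s" using st by auto
    have 0: "\<phi> 0 = 0" by (simp add: \<phi>_def)
    have "(\<Sum>i<s. \<phi> (if i = j then real s * r else 0)) = (\<Sum>i<s. if i = j then \<phi> (real s * r) else 0)"
      by (intro sum.cong) (auto simp: 0)
    also have "\<dots> = \<phi> (real s * r)" using j by simp
    finally have "(\<Sum>j<s. \<phi> (fst (alt_rates s r st) j)) - (\<Sum>j<s. \<phi> (snd (alt_rates s r st) j))
        = real s * \<phi> r - \<phi> (real s * r)"
      by (simp add: Some alt_rates_def)
    also have "\<dots> = real s * r / S * (log 2 (S / r) - log 2 (S / (real s * r)))"
      by (simp add: \<phi>_def algebra_simps)
    also have "log 2 (S / r) - log 2 (S / (real s * r)) = log 2 (real s)"
      using s r S by (simp add: log_divide log_mult)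
    finally show ?thesis by (simp add: Some)
  qed
  have "(\<Sum>(u, j)\<in>{..U} \<times> {..<s}. \<phi> (fst (rates U \<mu> (alt_rates s r) \<omega> u) j))
       - (\<Sum>(u, j)\<in>{..U} \<times> {..<s}. \<phi> (snd (rates U \<mu> (alt_rates s r) \<omega> u) j))
     = (\<Sum>u<U. (\<Sum>j<s. \<phi> (fst (alt_rates s r (\<omega> u)) j)) - (\<Sum>j<s. \<phi> (snd (alt_rates s r (\<omega> u)) j)))"
    unfolding sum_units[of \<phi> "\<lambda>u. fst (rates U \<mu> (alt_rates s r) \<omega> u)"]
      sum_units[of \<phi> "\<lambda>u. snd (rates U \<mu> (alt_rates s r) \<omega> u)"]
    by (simp add: rates_def sum_subtractf)
  also have "\<dots> = (\<Sum>u<U. if \<omega> u = None then 0 else real s * r / S * log 2 (real s))"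
    using \<omega> by (intro sum.cong unit) auto
  also have "\<dots> = (\<Sum>u\<in>{u\<in>{..<U}. \<omega> u \<noteq> None}. real s * r / S * log 2 (real s))"
    by (intro sum.mono_neutral_cong_right) auto
  finally show ?thesis by simp
qed

lemma set_unit_state: "0 < s \<Longrightarrow> set_pmf (unit_state \<kappa> s) \<subseteq> insert None (Some ` {..<s})"
  by (auto simp: unit_state_def set_pmf_of_set[of "{..<s}"] lessThan_empty_iff bot_nat_def split: if_splits)

text \<open>Each of the first \<open>U\<close> units is heavy with probability
  \<open>\<kappa>\<close>, so \<open>\<kappa> * U\<close> are expected; Markov's inequality bounds
  the tail.\<close>

lemma heavy_units_Markov:
  assumes \<kappa>: "0 < \<kappa>" "\<kappa> \<le> 1" and s: "0 < s" and U: "0 < U" and t: "0 < t"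
  defines "\<Omega> \<equiv> Pi_pmf {..U} None (\<lambda>_. unit_state \<kappa> s)"
  shows "measure_pmf.prob \<Omega> {\<omega>. t * (\<kappa> * real U) \<le> real (card {u\<in>{..<U}. \<omega> u = None})} \<le> 1 / t"
proof -
  define N where "N \<omega> = real (card {u\<in>{..<U}. \<omega> u = None})" for \<omega> :: "nat \<Rightarrow> nat option"
  have N: "N \<omega> = (\<Sum>u<U. indicator {None} (\<omega> u))" for \<omega>
  proof -
    have "{u\<in>{..<U}. \<omega> u = None} = {..<U} \<inter> {u. \<omega> u \<in> {None}}" by auto
    then show ?thesis by (simp add: N_def indicator_def sum.If_cases)
  qed
  have NU: "0 \<le> N \<omega>" "N \<omega> \<le> real U" for \<omega>
    using card_mono[of "{..<U}" "{u\<in>{..<U}. \<omega> u = None}"] by (auto simp: N_def)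
  have None: "pmf (unit_state \<kappa> s) None = \<kappa>"
    using pmf_bind_unit_state[of \<kappa> s return_pmf None] \<kappa> s by (simp add: bind_return_pmf')
  have E1: "measure_pmf.expectation \<Omega> (\<lambda>\<omega>. indicator {None} (\<omega> u)) = \<kappa>" if "u < U" for u
  proof -
    have "measure_pmf.expectation \<Omega> (\<lambda>\<omega>. indicator {None} (\<omega> u) :: real)
      = measure_pmf.expectation (map_pmf (\<lambda>\<omega>. \<omega> u) \<Omega>) (indicator {None})"
      by (simp only: integral_map_pmf)
    also have "map_pmf (\<lambda>\<omega>. \<omega> u) \<Omega> = unit_state \<kappa> s"
      using that by (simp add: \<Omega>_def Pi_pmf_component)
    also have "measure_pmf.expectation (unit_state \<kappa> s) (indicator {None}) = \<kappa>"
      by (simp add: measure_pmf_single None)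
    finally show ?thesis .
  qed
  have "measure_pmf.expectation \<Omega> N = (\<Sum>u<U. measure_pmf.expectation \<Omega> (\<lambda>\<omega>. indicator {None} (\<omega> u)))"
    unfolding N by (intro Bochner_Integration.integral_sum integrable_measure_pmf_bounded[where B=1]) auto
  also have "\<dots> = real U * \<kappa>" using E1 by simp
  finally have EN: "measure_pmf.expectation \<Omega> N = \<kappa> * real U" by simp
  have "measure_pmf.prob \<Omega> {\<omega>\<in>space (measure_pmf \<Omega>). t * (\<kappa> * real U) \<le> N \<omega>}
      \<le> measure_pmf.expectation \<Omega> N / (t * (\<kappa> * real U))"
    using NU \<kappa> U t by (intro integral_Markov_inequality_measure[where A="{}"])
      (auto intro!: integrable_measure_pmf_bounded[where B="real U"])
  also have "\<dots> = 1 / t" using \<kappa> U by (simp add: EN)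
  finally show ?thesis by (simp add: N_def)
qed

section \<open>From the guarantee of a tester to bounds on its acceptance of unit counts\<close>

lemma pmf_True_le_of_False: "2/3 \<le> pmf V False \<Longrightarrow> pmf V True \<le> 1/3"
  using pmf_False_conv_True[of V] by simp

text \<open>For one fixed assignment of rates, the normalised rates relabelled by
  \<open>\<iota>\<close> are distributions over \<open>{1..n}\<close> to which the guarantee of
  \<open>A\<close> applies. The factor \<open>(7/8)^2\<close> is the price of Poissonization, paid
  only in the lower bound.\<close>

lemma poissonized_tester_bounds:
  fixes \<theta> :: "'i \<Rightarrow> ('b \<Rightarrow> real) \<times> ('b \<Rightarrow> real)" and \<iota> :: "'i \<times> 'b \<Rightarrow> nat"
  assumes I: "finite I" and J: "finite J" and m: "1 \<le> m"
    and nonneg: "\<And>u j. 0 \<le> fst (\<theta> u) j" "\<And>u j. 0 \<le> snd (\<theta> u) j"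
    and total: "(\<Sum>(u, j)\<in>I \<times> J. fst (\<theta> u) j) = S" "(\<Sum>(u, j)\<in>I \<times> J. snd (\<theta> u) j) = S"
    and S: "16 * real m \<le> S"
    and \<iota>: "inj_on \<iota> (I \<times> J)" "\<iota> ` (I \<times> J) \<subseteq> {1..n}"
    and dist: "distinguishes A m n \<epsilon>"
  defines "\<phi> \<equiv> \<lambda>y::real. y / S * log 2 (1 / (y / S))"
  defines "T \<equiv> \<lambda>xs ys. A (map \<iota> xs) (map \<iota> ys)"
  defines "W \<equiv> bind_pmf (Pi_pmf I (\<lambda>_. 0, \<lambda>_. 0) (\<lambda>u. unit_counts J (\<theta> u)))
    (\<lambda>h. poissonized_tester m T (merge_units h))"
  shows "(\<And>u j. fst (\<theta> u) j = snd (\<theta> u) j) \<Longrightarrow> (7/8)\<^sup>2 * (2/3) \<le> pmf W True"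
    and "\<epsilon> \<le> (\<Sum>(u, j)\<in>I \<times> J. \<phi> (fst (\<theta> u) j)) - (\<Sum>(u, j)\<in>I \<times> J. \<phi> (snd (\<theta> u) j))
      \<Longrightarrow> pmf W True \<le> 1/3"
proof -
  define a where "a = (\<lambda>(u, j). fst (\<theta> u) j)"
  define b where "b = (\<lambda>(u, j). snd (\<theta> u) j)"
  have fin: "finite (I \<times> J)" using I J by simp
  have ab: "0 \<le> a x" "0 \<le> b x" for x using nonneg by (auto simp: a_def b_def split: prod.split)
  have sums: "(\<Sum>x\<in>I \<times> J. a x) = S" "(\<Sum>x\<in>I \<times> J. b x) = S" using total by (auto simp: a_def b_def)
  have S0: "0 < S" using S m by linarith
  obtain p where p: "\<And>x. pmf p x = (if x \<in> I \<times> J then a x / S else 0)" "set_pmf p \<subseteq> I \<times> J"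
    using normalized_pmf[of "I \<times> J" a] fin ab S0 unfolding sums by metis
  obtain q where q: "\<And>x. pmf q x = (if x \<in> I \<times> J then b x / S else 0)" "set_pmf q \<subseteq> I \<times> J"
    using normalized_pmf[of "I \<times> J" b] fin ab S0 unfolding sums by metis
  have dists: "map_pmf \<iota> p \<in> dists n" "map_pmf \<iota> q \<in> dists n"
    using map_pmf_in_dists[OF p(2) \<iota>(2)] map_pmf_in_dists[OF q(2) \<iota>(2)] .
  have V: "bind_pmf (replicate_pmf m p) (\<lambda>xs. bind_pmf (replicate_pmf m q) (T xs))
      = verdict A m (map_pmf \<iota> p) (map_pmf \<iota> q)"
    by (simp add: verdict_map_pmf T_def)
  have W: "W = bind_pmf (pair_pmf (Pi_pmf (I \<times> J) 0 (\<lambda>x. pois (a x))) (Pi_pmf (I \<times> J) 0 (\<lambda>x. pois (b x))))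
      (poissonized_tester m T)"
  proof -
    have "W = bind_pmf (map_pmf merge_units (Pi_pmf I (\<lambda>_. 0, \<lambda>_. 0) (\<lambda>u. unit_counts J (\<theta> u))))
        (poissonized_tester m T)"
      by (simp add: W_def bind_map_pmf)
    moreover have "(\<lambda>(u, j). pois (fst (\<theta> u) j)) = (\<lambda>x. pois (a x))"
      "(\<lambda>(u, j). pois (snd (\<theta> u) j)) = (\<lambda>x. pois (b x))"
      by (auto simp: a_def b_def)
    ultimately show ?thesis unfolding merge_unit_counts[OF I J] by simp
  qed
  have le: "pmf W True \<le> pmf (verdict A m (map_pmf \<iota> p) (map_pmf \<iota> q)) True"
    "(7/8)\<^sup>2 * pmf (verdict A m (map_pmf \<iota> p) (map_pmf \<iota> q)) True \<le> pmf W True"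
    unfolding W V[symmetric]
    by (rule pmf_poissonized_tester[OF fin]; use ab m S p(1) q(1) sums in simp)+
  show "(7/8)\<^sup>2 * (2/3) \<le> pmf W True" if "\<And>u j. fst (\<theta> u) j = snd (\<theta> u) j"
  proof -
    have "a = b" using that by (auto simp: a_def b_def)
    then have "p = q" using p(1) q(1) by (intro pmf_eqI) simp
    then have "2/3 \<le> pmf (verdict A m (map_pmf \<iota> p) (map_pmf \<iota> q)) True"
      using dist dists by (auto simp: distinguishes_def)
    then have "(7/8)\<^sup>2 * (2/3) \<le> (7/8)\<^sup>2 * pmf (verdict A m (map_pmf \<iota> p) (map_pmf \<iota> q)) True"
      by (rule mult_left_mono) simp
    then show ?thesis using le(2) by (rule order_trans)
  qed
  show "pmf W True \<le> 1/3"
    if gap: "\<epsilon> \<le> (\<Sum>(u, j)\<in>I \<times> J. \<phi> (fst (\<theta> u) j)) - (\<Sum>(u, j)\<in>I \<times> J. \<phi> (snd (\<theta> u) j))"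
  proof -
    have "shannon_entropy n (map_pmf \<iota> p) = (\<Sum>x\<in>I \<times> J. \<phi> (a x))"
      unfolding shannon_entropy_map_pmf[OF fin p(2) \<iota>] by (intro sum.cong) (auto simp: p(1) \<phi>_def)
    moreover have "shannon_entropy n (map_pmf \<iota> q) = (\<Sum>x\<in>I \<times> J. \<phi> (b x))"
      unfolding shannon_entropy_map_pmf[OF fin q(2) \<iota>] by (intro sum.cong) (auto simp: q(1) \<phi>_def)
    ultimately have "\<epsilon> \<le> \<bar>shannon_entropy n (map_pmf \<iota> p) - shannon_entropy n (map_pmf \<iota> q)\<bar>"
      using gap by (simp add: a_def b_def case_prod_unfold)
    then have "2/3 \<le> pmf (verdict A m (map_pmf \<iota> p) (map_pmf \<iota> q)) False"
      using dist dists by (auto simp: distinguishes_def)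
    then show ?thesis using le(1) pmf_True_le_of_False by fastforce
  qed
qed

lemma rates_nonneg:
  assumes "0 \<le> \<mu>" "0 \<le> r"
  shows "0 \<le> fst (rates U \<mu> (null_rates r) \<omega> u) j" "0 \<le> snd (rates U \<mu> (null_rates r) \<omega> u) j"
    "0 \<le> fst (rates U \<mu> (alt_rates s r) \<omega> u) j" "0 \<le> snd (rates U \<mu> (alt_rates s r) \<omega> u) j"
  using assms by (auto simp: rates_def null_rates_def alt_rates_def split: option.split)

text \<open>A product of mixtures is the mixture, over independent states, of the products. The
  reserve unit also draws a state so that both products have the index set
  \<open>{..U}\<close>.\<close>

lemma Pi_pmf_bind_unit_state:
  "Pi_pmf {..U} d (\<lambda>u. bind_pmf (unit_state \<kappa> s) (\<lambda>st. unit_counts J (if u < U then R st else (\<lambda>_. \<mu>, \<lambda>_. \<mu>))))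
   = bind_pmf (Pi_pmf {..U} None (\<lambda>_. unit_state \<kappa> s)) (\<lambda>\<omega>. Pi_pmf {..U} d (\<lambda>u. unit_counts J (rates U \<mu> R \<omega> u)))"
  by (subst Pi_pmf_bind[where d' = None]) (simp_all add: rates_def)

text \<open>\<open>(1 + t) ^ U \<le> exp (1/200) \<le> 1 + 1/100\<close>: a total divergence of
  1/200 shifts acceptance probabilities by at most 1/10.\<close>

lemma sqrt_power_minus_one_le:
  fixes t :: real
  assumes "0 \<le> t" "real U * t \<le> 1/200"
  shows "sqrt ((1 + t) ^ U - 1) \<le> 1/10"
proof -
  have "(1 + t) ^ U \<le> exp t ^ U" using assms exp_ge_add_one_self[of t] by (intro power_mono) auto
  also have "\<dots> = exp (real U * t)" by (simp add: exp_of_nat_mult)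
  also have "\<dots> \<le> exp (1/200)" using assms by simp
  also have "\<dots> \<le> 1 + 1/200 + (1/200)\<^sup>2" by (rule exp_bound) auto
  also have "\<dots> \<le> 1 + (1/10)\<^sup>2" by (simp add: power2_eq_square)
  finally have "(1 + t) ^ U - 1 \<le> (1/10)\<^sup>2" by simp
  then show ?thesis by (rule real_le_lsqrt[rotated]) auto
qed

text \<open>Averaged over the states, acceptance is at least \<open>(7/8)^2 * (2/3) = 49/96\<close>
  under the null hypothesis and at most \<open>1/3 + 1/50\<close> under the alternative, yet the two
  differ by at most 1/10. The entropy gap is required for every number \<open>h\<close> of heavy
  units that Markov's inequality leaves likely.\<close>

lemma collision_lower_bound:
  fixes \<kappa> r \<mu> \<epsilon> :: real
  assumes dist: "distinguishes A m n \<epsilon>" and m: "1 \<le> m"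
    and U: "1 \<le> U" and s: "0 < s" and n: "s * (U + 1) \<le> n"
    and \<kappa>: "0 < \<kappa>" "\<kappa> \<le> 1" and r: "0 < r" "real s * r \<le> 1" and \<mu>: "16 * real m \<le> real s * \<mu>"
    and chi: "real U * ((exp (2 * real s) * (real s * r)\<^sup>2)\<^sup>2 / \<kappa>) \<le> 1/200"
    and gap: "\<And>h. 0 \<le> h \<Longrightarrow> h \<le> 50 * (\<kappa> * real U) \<Longrightarrow> h \<le> real U \<Longrightarrow>
      \<epsilon> \<le> (real U - h) * (real s * r / (real s * \<mu> + real s * h + real s * r * (real U - h)) * log 2 (real s))"
  shows False
proof -
  define t where "t = (exp (2 * real s) * (real s * r)\<^sup>2)\<^sup>2 / \<kappa>"
  \<comment> \<open>Unit \<open>u\<close> occupies the numbers \<open>s * u + 1\<close> to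
    \<open>s * u + s\<close>; with the reserve there are \<open>U + 1\<close> units.\<close>
  define \<iota> where "\<iota> = (\<lambda>(u::nat, j::nat). s * u + j + 1)"
  define T where "T = (\<lambda>xs ys. A (map \<iota> xs) (map \<iota> ys))"
  define \<Omega> where "\<Omega> = Pi_pmf {..U} None (\<lambda>_. unit_state \<kappa> s)"
  define f where "f h = pmf (poissonized_tester m T (merge_units h)) True" for h
  define d :: "(nat \<Rightarrow> nat) \<times> (nat \<Rightarrow> nat)" where "d = (\<lambda>_. 0, \<lambda>_. 0)"
  \<comment> \<open>\<open>L\<close> averages over the state of a unit, \<open>W\<close> keeps all
    states \<open>\<omega>\<close> fixed. The divergence is small for the averaged laws, whereas the
    guarantee of the tester holds for fixed states.\<close>
  define L where "L R u = bind_pmf (unit_state \<kappa> s)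
    (\<lambda>st. unit_counts {..<s} (if u < U then R st else (\<lambda>_. \<mu>, \<lambda>_. \<mu>)))" for R u
  define W where "W R \<omega> = bind_pmf (Pi_pmf {..U} d (\<lambda>u. unit_counts {..<s} (rates U \<mu> R \<omega> u)))
    (\<lambda>h. poissonized_tester m T (merge_units h))" for R \<omega>
  have t: "0 \<le> t" using \<kappa> by (simp add: t_def)
  have \<mu>0: "0 < \<mu>"
  proof -
    have "0 < real s * \<mu>" using m \<mu> by linarith
    then show ?thesis using s by (simp add: zero_less_mult_iff)
  qed
  have inj: "inj_on \<iota> ({..U} \<times> {..<s})"
  proof (rule inj_onI, clarify)
    fix u j v k assume j: "j < s" "k < s" and eq: "\<iota> (u, j) = \<iota> (v, k)"
    then have eq: "s * u + j = s * v + k" by (simp add: \<iota>_def)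
    then have "(s * u + j) div s = (s * v + k) div s" by simp
    then have "u = v" using j s by simp
    with eq show "u = v \<and> j = k" by simp
  qed
  have range: "\<iota> ` ({..U} \<times> {..<s}) \<subseteq> {1..n}"
  proof clarify
    fix u j assume "u \<le> U" "j < s"
    then have "s * u + (j + 1) \<le> s * U + s" by (intro add_mono mult_left_mono) auto
    then show "\<iota> (u, j) \<in> {1..n}" using n by (simp add: \<iota>_def algebra_simps)
  qed
  have E: "measure_pmf.expectation (Pi_pmf {..U} d (L R)) f
      = measure_pmf.expectation \<Omega> (\<lambda>\<omega>. pmf (W R \<omega>) True)" for R
  proof -
    have "measure_pmf.expectation (Pi_pmf {..U} d (L R)) f
      = pmf (bind_pmf (Pi_pmf {..U} d (L R)) (\<lambda>h. poissonized_tester m T (merge_units h))) True"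
      by (simp add: pmf_bind f_def[abs_def])
    also have "\<dots> = pmf (bind_pmf \<Omega> (W R)) True"
      unfolding L_def Pi_pmf_bind_unit_state bind_assoc_pmf \<Omega>_def W_def ..
    finally show ?thesis by (simp add: pmf_bind)
  qed
  \<comment> \<open>The reserve has the same law under both hypotheses, hence the factor 1 at
    \<open>u = U\<close>.\<close>
  have "\<bar>measure_pmf.expectation (Pi_pmf {..U} d (L (alt_rates s r))) f
      - measure_pmf.expectation (Pi_pmf {..U} d (L (null_rates r))) f\<bar>
    \<le> sqrt ((\<Prod>u\<le>U. 1 + (if u < U then t else 0)) - 1)"
  proof (rule expectation_diff_le_chi_square_Pi_pmf[where
        B = "1 + exp (2 * real s) * (real s * r)\<^sup>2 / \<kappa>"])
    fix u
    show "pmf (L (alt_rates s r) u) x \<le> (1 + exp (2 * real s) * (real s * r)\<^sup>2 / \<kappa>) * pmf (L (null_rates r) u) x" for x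
    proof (cases "u < U")
      case True
      then show ?thesis using unit_chi_square(1)[OF \<kappa> s _ r(2), of x] r by (simp add: L_def)
    next
      case False
      have "1 * pmf (L (null_rates r) u) x \<le> (1 + exp (2 * real s) * (real s * r)\<^sup>2 / \<kappa>) * pmf (L (null_rates r) u) x"
        using \<kappa> by (intro mult_right_mono) auto
      then show ?thesis using False by (simp add: L_def)
    qed
    show "measure_pmf.expectation (L (null_rates r) u) (\<lambda>x. (pmf (L (alt_rates s r) u) x / pmf (L (null_rates r) u) x)\<^sup>2)
        \<le> 1 + (if u < U then t else 0)"
    proof (cases "u < U")
      case True
      then show ?thesis using unit_chi_square(2)[OF \<kappa> s _ r(2)] r by (simp add: L_def t_def)
    next
      case False
      have "L (alt_rates s r) u = L (null_rates r) u" using False by (simp add: L_def)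
      moreover have "measure_pmf.expectation (L (null_rates r) u)
          (\<lambda>x. (pmf (L (null_rates r) u) x / pmf (L (null_rates r) u) x)\<^sup>2) \<le> 1 + 0"
        by (rule chi_square_le_dominated[where B = 1 and H = "L (null_rates r) u"]) auto
      ultimately show ?thesis using False by simp
    qed
  qed (auto simp: f_def pmf_le_1)
  also have "(\<Prod>u\<le>U. 1 + (if u < U then t else 0)) = (1 + t) ^ U"
    by (simp flip: lessThan_Suc_atMost)
  also have "sqrt ((1 + t) ^ U - 1) \<le> 1/10"
    using t chi by (intro sqrt_power_minus_one_le) (auto simp: t_def)
  finally have close: "measure_pmf.expectation \<Omega> (\<lambda>\<omega>. pmf (W (null_rates r) \<omega>) True)
      \<le> measure_pmf.expectation \<Omega> (\<lambda>\<omega>. pmf (W (alt_rates s r) \<omega>) True) + 1/10"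
    unfolding E by linarith
  have supp: "\<omega> u \<in> insert None (Some ` {..<s})" if "\<omega> \<in> set_pmf \<Omega>" "u < U" for \<omega> u
    using that set_Pi_pmf[of "{..U}" None "\<lambda>_. unit_state \<kappa> s"] set_unit_state[OF s, of \<kappa>]
    by (auto simp: \<Omega>_def PiE_dflt_def)
  have total: "16 * real m \<le> total_rate s U \<mu> r \<omega>" for \<omega>
    using \<mu> r by (auto simp: total_rate_def intro!: order_trans[OF \<mu>] sum_nonneg)
  have "measure_pmf.expectation \<Omega> (\<lambda>_. (7/8)\<^sup>2 * (2/3))
      \<le> measure_pmf.expectation \<Omega> (\<lambda>\<omega>. pmf (W (null_rates r) \<omega>) True)"
  proof (rule integral_mono_AE)
    show "AE \<omega> in measure_pmf \<Omega>. (7/8)\<^sup>2 * (2/3) \<le> pmf (W (null_rates r) \<omega>) True"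
      unfolding AE_measure_pmf_iff
    proof
      fix \<omega> assume \<omega>: "\<omega> \<in> set_pmf \<Omega>"
      show "(7/8)\<^sup>2 * (2/3) \<le> pmf (W (null_rates r) \<omega>) True"
        unfolding W_def d_def T_def
        by (rule poissonized_tester_bounds(1)[OF _ _ m rates_nonneg(1,2) sum_rates(1,2) total inj range dist])
          (use supp[OF \<omega>] \<mu>0 r in \<open>auto simp: rates_def null_rates_def split: option.split\<close>)
    qed
  qed (auto intro!: integrable_measure_pmf_bounded[where B=1] simp: pmf_le_1)
  then have lower: "49/96 \<le> measure_pmf.expectation \<Omega> (\<lambda>\<omega>. pmf (W (null_rates r) \<omega>) True)"
    by (simp add: power2_eq_square)
  \<comment> \<open>With too many heavy units the entropy gap may be lost; there acceptance is
    bounded by 1, at a total cost of at most 1/50.\<close>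
  define Bad where "Bad = {\<omega>. 50 * (\<kappa> * real U) \<le> real (card {u\<in>{..<U}. \<omega> u = (None :: nat option)})}"
  have "measure_pmf.expectation \<Omega> (\<lambda>\<omega>. pmf (W (alt_rates s r) \<omega>) True)
      \<le> measure_pmf.expectation \<Omega> (\<lambda>\<omega>. 1/3 + indicator Bad \<omega>)"
  proof (rule integral_mono_AE)
    show "AE \<omega> in measure_pmf \<Omega>. pmf (W (alt_rates s r) \<omega>) True \<le> 1/3 + indicator Bad \<omega>"
      unfolding AE_measure_pmf_iff
    proof
      fix \<omega> assume \<omega>: "\<omega> \<in> set_pmf \<Omega>"
      show "pmf (W (alt_rates s r) \<omega>) True \<le> 1/3 + indicator Bad \<omega>"
      proof (cases "\<omega> \<in> Bad")
        case True
        then show ?thesis using pmf_le_1[of "W (alt_rates s r) \<omega>" True] by simp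
      next
        case False
        define h where "h = card {u\<in>{..<U}. \<omega> u = None}"
        have hU: "h \<le> U" using card_mono[of "{..<U}" "{u\<in>{..<U}. \<omega> u = None}"] by (auto simp: h_def)
        have "{u\<in>{..<U}. \<omega> u \<noteq> None} = {..<U} - {u\<in>{..<U}. \<omega> u = None}" by auto
        moreover have "card ({..<U} - {u\<in>{..<U}. \<omega> u = None}) = U - h"
          unfolding h_def by (subst card_Diff_subset) auto
        ultimately have light: "card {u\<in>{..<U}. \<omega> u \<noteq> None} = U - h" by simp
        have "(\<Sum>u<U. if \<omega> u = None then real s else real s * r) = real s * real h + real s * r * (real U - real h)"
        proof -
          have "{..<U} \<inter> {u. \<omega> u = None} = {u\<in>{..<U}. \<omega> u = None}"
            "{..<U} \<inter> - {u. \<omega> u = None} = {u\<in>{..<U}. \<omega> u \<noteq> None}" by auto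
          moreover have "card {u\<in>{..<U}. \<omega> u = None} = h" by (simp only: h_def)
          ultimately show ?thesis using light hU by (simp add: sum.If_cases of_nat_diff mult_ac)
        qed
        then have tot: "total_rate s U \<mu> r \<omega> = real s * \<mu> + real s * real h + real s * r * (real U - real h)"
          by (simp add: total_rate_def)
        have "\<epsilon> \<le> (real U - real h) * (real s * r / total_rate s U \<mu> r \<omega> * log 2 (real s))"
          unfolding tot using False hU by (intro gap) (auto simp: Bad_def h_def)
        then have gap\<omega>: "\<epsilon> \<le> real (card {u\<in>{..<U}. \<omega> u \<noteq> None})
            * (real s * r / total_rate s U \<mu> r \<omega> * log 2 (real s))"
          unfolding light using hU by (simp add: of_nat_diff)
        have pos: "0 < total_rate s U \<mu> r \<omega>" using total[of \<omega>] m by linarith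
        have "pmf (W (alt_rates s r) \<omega>) True \<le> 1/3"
          unfolding W_def d_def T_def
          by (rule poissonized_tester_bounds(2)[OF _ _ m rates_nonneg(3,4) sum_rates(3,4) total inj range dist
                ord_le_eq_trans[OF gap\<omega> entropy_gap[OF supp[OF \<omega>] s r(1) pos, symmetric]]])
            (use supp[OF \<omega>] \<mu>0 r in auto)
        then show ?thesis using False by simp
      qed
    qed
  qed (rule integrable_measure_pmf_bounded[where B=1], simp add: pmf_le_1,
       rule integrable_measure_pmf_bounded[where B="4/3"], simp add: indicator_def)
  also have "\<dots> = 1/3 + measure_pmf.prob \<Omega> Bad"
    by (subst Bochner_Integration.integral_add) (auto intro!: integrable_measure_pmf_bounded[where B=1])
  also have "measure_pmf.prob \<Omega> Bad \<le> 1/50"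
    unfolding Bad_def \<Omega>_def using heavy_units_Markov[OF \<kappa> s, of U 50] U by simp
  finally show False using close lower by simp
qed

subsection \<open>The two-point instance\<close>

text \<open>Presents a list of samples as a product over indices, to which the tensorised bound
  applies. The new index comes last, so the induction appends at the end of the list.\<close>

lemma map_Pi_pmf_eq_replicate_pmf:
  "map_pmf (\<lambda>\<omega>. map \<omega> [0..<m]) (Pi_pmf {..<m} d (\<lambda>_. p)) = replicate_pmf m p"
proof (induction m)
  case (Suc m)
  have *: "map (\<lambda>i. if i = m then y else \<omega> i) [0..<m] = map \<omega> [0..<m]" for y and \<omega> :: "nat \<Rightarrow> 'a"
    by (intro map_cong) auto
  have "map_pmf (\<lambda>\<omega>. map \<omega> [0..<Suc m]) (Pi_pmf {..<Suc m} d (\<lambda>_. p))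
    = bind_pmf p (\<lambda>y. bind_pmf (Pi_pmf {..<m} d (\<lambda>_. p)) (\<lambda>\<omega>. return_pmf (map \<omega> [0..<m] @ [y])))"
    by (simp add: lessThan_Suc Pi_pmf_insert' map_bind_pmf * fun_upd_def)
  also have "\<dots> = bind_pmf (map_pmf (\<lambda>\<omega>. map \<omega> [0..<m]) (Pi_pmf {..<m} d (\<lambda>_. p)))
      (\<lambda>xs. bind_pmf p (\<lambda>y. return_pmf (xs @ [y])))"
    unfolding bind_map_pmf by (rule bind_commute_pmf)
  also have "\<dots> = replicate_pmf (m + 1) p"
    unfolding Suc replicate_pmf_distrib replicate_pmf_1 by (simp add: bind_map_pmf)
  finally show ?case by simp
qed simp

text \<open>The pairs \<open>(P, P)\<close> and \<open>(P, Q)\<close> differ only in the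
  \<open>m\<close> samples from the second distribution. If \<open>m * t \<le> 1/200\<close>,
  acceptance changes by at most 1/10, while the tester must bring it from 2/3 down to 1/3.\<close>

lemma samples_needed_for_close_alternatives:
  fixes P Q :: "nat pmf"
  assumes dist: "distinguishes A m n \<epsilon>" and PQ: "P \<in> dists n" "Q \<in> dists n"
    and gap: "\<epsilon> \<le> \<bar>shannon_entropy n P - shannon_entropy n Q\<bar>"
    and ac: "\<And>x. pmf Q x \<le> B * pmf P x"
    and t: "0 \<le> t" and close: "\<And>x. (pmf Q x - pmf P x)\<^sup>2 \<le> t * pmf P x * pmf P x"
  shows "1/200 < real m * t"
proof (rule ccontr)
  assume "\<not> 1/200 < real m * t"
  then have small: "sqrt ((1 + t) ^ m - 1) \<le> 1/10" using t by (intro sqrt_power_minus_one_le) auto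
  define f where "f ys = pmf (bind_pmf (replicate_pmf m P) (\<lambda>xs. A xs ys)) True" for ys
  define g where "g \<omega> = f (map \<omega> [0..<m])" for \<omega>
  have E: "pmf (verdict A m P R) True = measure_pmf.expectation (Pi_pmf {..<m} 0 (\<lambda>_. R)) g" for R
  proof -
    have "verdict A m P R = bind_pmf (replicate_pmf m R) (\<lambda>ys. bind_pmf (replicate_pmf m P) (\<lambda>xs. A xs ys))"
      unfolding verdict_def by (rule bind_commute_pmf)
    then have "pmf (verdict A m P R) True = measure_pmf.expectation (replicate_pmf m R) f"
      by (simp add: pmf_bind[of "replicate_pmf m R"] f_def[abs_def])
    then show ?thesis
      unfolding map_Pi_pmf_eq_replicate_pmf[of m 0 R, symmetric] by (simp add: g_def[abs_def])
  qed
  have "\<bar>measure_pmf.expectation (Pi_pmf {..<m} 0 (\<lambda>_. Q)) g - measure_pmf.expectation (Pi_pmf {..<m} 0 (\<lambda>_. P)) g\<bar>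
      \<le> sqrt ((\<Prod>i<m. 1 + t) - 1)"
  proof (rule expectation_diff_le_chi_square_Pi_pmf[OF _ ac])
    show "measure_pmf.expectation P (\<lambda>x. (pmf Q x / pmf P x)\<^sup>2) \<le> 1 + t"
      by (rule chi_square_le_dominated[OF ac t close])
  qed (auto simp: g_def f_def pmf_le_1)
  then have "pmf (verdict A m P P) True - pmf (verdict A m P Q) True \<le> 1/10"
    using small by (simp add: E)
  moreover have "2/3 \<le> pmf (verdict A m P P) True"
    using dist PQ by (auto simp: distinguishes_def)
  moreover have "pmf (verdict A m P Q) True \<le> 1/3"
    using dist PQ gap by (intro pmf_True_le_of_False) (auto simp: distinguishes_def)
  ultimately show False by simp
qed

text \<open>\<open>f x / ln 2\<close> is the binary entropy of \<open>x\<close> minus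
  \<open>x\<close>. Its derivative is nonnegative while \<open>2 * x \<le> 1 - x\<close>, which
  covers the whole interval up to \<open>1/8 + d \<le> 1/4\<close>.\<close>

lemma binary_entropy_increment:
  fixes d :: real
  assumes "0 \<le> d" "d \<le> 1/8"
  shows "(-7/8 * log 2 (7/8) - 1/8 * log 2 (1/8)) + d
    \<le> - (7/8 - d) * log 2 (7/8 - d) - (1/8 + d) * log 2 (1/8 + d)"
proof -
  define f where "f x = (x - 1) * ln (1 - x) - x * ln x - x * ln 2" for x :: real
  have "f (1/8) \<le> f (1/8 + d)"
  proof (rule DERIV_nonneg_imp_nondecreasing[where f = f])
    fix x :: real assume x: "1/8 \<le> x" "x \<le> 1/8 + d"
    then have x': "0 < x" "x \<le> 1/4" using assms by auto
    have "(f has_real_derivative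
        (ln (1 - x) + (x - 1) * (- 1 / (1 - x)) - (ln x + x * (1 / x)) - ln 2)) (at x)"
      unfolding f_def using x' by (auto intro!: derivative_eq_intros)
    moreover have "(x - 1) * (- 1 / (1 - x)) = 1" "x * (1 / x) = 1" using x' by (auto simp: field_simps)
    ultimately have "(f has_real_derivative (ln (1 - x) - ln x - ln 2)) (at x)" by simp
    moreover have "ln (x * 2) \<le> ln (1 - x)" using x' by (subst ln_le_cancel_iff) auto
    then have "0 \<le> ln (1 - x) - ln x - ln 2" using x' by (simp add: ln_mult)
    ultimately show "\<exists>y. (f has_real_derivative y) (at x) \<and> 0 \<le> y" by blast
  qed (use assms in auto)
  then have "f (1/8) / ln 2 \<le> f (1/8 + d) / ln 2" by (intro divide_right_mono) auto
  then show ?thesis by (simp add: f_def log_def diff_divide_distrib add_divide_distrib algebra_simps)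
qed

lemma two_level_distribution:
  fixes a :: real
  assumes n: "2 \<le> n" and a: "0 < a" "a < 1"
  obtains p where "p \<in> dists n"
    "\<And>x. pmf p x = (if x = 1 then 1 - a else if x \<in> {2..n} then a / real (n - 1) else 0)"
    "shannon_entropy n p = - (1 - a) * log 2 (1 - a) - a * log 2 a + a * log 2 (real (n - 1))"
proof -
  define l where "l x = (if x = 1 then 1 - a else a / real (n - 1))" for x :: nat
  have set: "{1..n} = insert 1 {2..n}" using n by auto
  have card: "real (card {2..n}) = real (n - 1)" using n by (simp add: of_nat_diff)
  have n1: "0 < real (n - 1)" using n by simp
  have split: "(\<Sum>x\<in>{1..n}. g (l x)) = g (1 - a) + real (n - 1) * g (a / real (n - 1))" for g :: "real \<Rightarrow> real"
  proof -
    have "(\<Sum>x\<in>{2..n}. g (l x)) = (\<Sum>x\<in>{2..n}. g (a / real (n - 1)))"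
      by (intro sum.cong) (auto simp: l_def)
    also have "\<dots> = real (n - 1) * g (a / real (n - 1))" by (simp only: sum_constant card)
    finally show ?thesis unfolding set by (simp add: l_def)
  qed
  have sum1: "(\<Sum>x\<in>{1..n}. l x) = 1" using split[of "\<lambda>x. x"] n1 by simp
  obtain p where p: "\<And>x. pmf p x = (if x \<in> {1..n} then l x / 1 else 0)" "set_pmf p \<subseteq> {1..n}"
  proof (rule normalized_pmf[of "{1..n}" l])
    show "\<And>x. x \<in> {1..n} \<Longrightarrow> 0 \<le> l x" using a by (auto simp: l_def)
  qed (use sum1 that in \<open>auto simp only:\<close>)
  have "shannon_entropy n p = (\<Sum>x\<in>{1..n}. l x * log 2 (1 / l x))"
    unfolding shannon_entropy_def by (intro sum.cong) (auto simp: p(1))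
  also have "\<dots> = (1 - a) * log 2 (1 / (1 - a)) + a * log 2 (real (n - 1) / a)"
    using split[of "\<lambda>y. y * log 2 (1 / y)"] n1 by simp
  also have "\<dots> = - (1 - a) * log 2 (1 - a) - a * log 2 a + a * log 2 (real (n - 1))"
    using a n1 by (simp add: log_divide algebra_simps)
  finally have "shannon_entropy n p = - (1 - a) * log 2 (1 - a) - a * log 2 a + a * log 2 (real (n - 1))" .
  moreover have "pmf p x = (if x = 1 then 1 - a else if x \<in> {2..n} then a / real (n - 1) else 0)" for x
    using n by (auto simp: p(1) l_def)
  ultimately show thesis using that[of p] p(2) by (auto simp: dists_def)
qed

text \<open>Without samples the verdict cannot depend on the distributions, yet a point mass and a
  fair coin differ by exactly one bit.\<close>

lemma at_least_one_sample:
  assumes n: "2 \<le> n" and \<epsilon>: "\<epsilon> \<le> 1" and dist: "distinguishes A m n \<epsilon>"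
  shows "1 \<le> m"
proof (rule ccontr)
  assume "\<not> 1 \<le> m"
  then have "m = 0" by simp
  then have v: "verdict A m p q = A [] []" for p q by (simp add: verdict_def bind_return_pmf)
  define p :: "nat pmf" where "p = return_pmf 1"
  define q :: "nat pmf" where "q = pmf_of_set {1, 2}"
  have d: "p \<in> dists n" "q \<in> dists n" using n by (auto simp: dists_def p_def q_def)
  have "shannon_entropy n p = 0"
    using shannon_entropy_map_pmf[of "{1}" p "\<lambda>x. x" n] n by (simp add: p_def)
  moreover have "shannon_entropy n q = 1"
    using shannon_entropy_map_pmf[of "{1, 2}" q "\<lambda>x. x" n] n by (simp add: q_def)
  ultimately have "\<epsilon> \<le> \<bar>shannon_entropy n p - shannon_entropy n q\<bar>" using \<epsilon> by simp
  then have "2/3 \<le> pmf (A [] []) False" using dist d by (auto simp: distinguishes_def v)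
  moreover have "2/3 \<le> pmf (A [] []) True" using dist d by (auto simp: distinguishes_def v)
  ultimately show False using pmf_True_le_of_False[of "A [] []"] by simp
qed

text \<open>Moving mass \<open>d\<close> off the heavy point changes each probability by a factor
  within \<open>8 * d\<close> of 1, so the divergence per sample is at most \<open>64 * d^2\<close>;
  then \<open>1/200 < 64 * m * d^2\<close> yields the constant 1/12800.\<close>

lemma two_point_lower_bound:
  assumes n: "2 \<le> n" and \<epsilon>: "0 < \<epsilon>" "\<epsilon> \<le> 1" and dist: "distinguishes A m n \<epsilon>"
  shows "1/12800 * ((log 2 (real n))\<^sup>2 / \<epsilon>\<^sup>2) \<le> real m"
proof -
  define d where "d = \<epsilon> / log 2 (real n)"
  have log: "1 \<le> log 2 (real n)" using n by (simp add: le_log_iff)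
  have d0: "0 < d" using \<epsilon> log by (simp add: d_def)
  have L: "(log 2 (real n))\<^sup>2 / \<epsilon>\<^sup>2 = 1 / d\<^sup>2" by (simp add: d_def power_divide)
  show ?thesis
  proof (cases "d \<le> 1/8")
    case False
    \<comment> \<open>For large \<open>d\<close> the claimed bound is at most
      \<open>64 / 12800\<close>, so one sample already exceeds it.\<close>
    then have "(1/8)\<^sup>2 \<le> d\<^sup>2" by (intro power_mono) auto
    then have "1 / d\<^sup>2 \<le> 1 / (1/8)\<^sup>2" using d0 by (intro divide_left_mono) auto
    moreover have "1 \<le> real m" using at_least_one_sample[OF n \<epsilon>(2) dist] by simp
    ultimately show ?thesis unfolding L by (simp add: power2_eq_square)
  next
    case True
    obtain P where P: "P \<in> dists n"
      "\<And>x. pmf P x = (if x = 1 then 1 - 1/8 else if x \<in> {2..n} then (1/8) / real (n - 1) else 0)"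
      "shannon_entropy n P = - (1 - 1/8) * log 2 (1 - 1/8) - (1/8) * log 2 (1/8) + (1/8) * log 2 (real (n - 1))"
      by (rule two_level_distribution[OF n, of "1/8"]) auto
    obtain Q where Q: "Q \<in> dists n"
      "\<And>x. pmf Q x = (if x = 1 then 1 - (1/8 + d) else if x \<in> {2..n} then (1/8 + d) / real (n - 1) else 0)"
      "shannon_entropy n Q = - (1 - (1/8 + d)) * log 2 (1 - (1/8 + d)) - (1/8 + d) * log 2 (1/8 + d)
        + (1/8 + d) * log 2 (real (n - 1))"
      by (rule two_level_distribution[OF n, of "1/8 + d"]) (use True d0 in auto)
    \<comment> \<open>Spreading over \<open>n - 1\<close> points instead of \<open>n\<close> loses
      at most one bit per unit of mass; the increment of the binary entropy by \<open>d\<close>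
      makes up for it.\<close>
    have "log 2 (real n) \<le> log 2 (2 * real (n - 1))" using n by (subst log_le_cancel_iff) auto
    also have "\<dots> = 1 + log 2 (real (n - 1))" using n by (subst log_mult) auto
    finally have "d * log 2 (real n) \<le> d * (1 + log 2 (real (n - 1)))" using d0 by (intro mult_left_mono) auto
    moreover have "d * log 2 (real n) = \<epsilon>" using log by (simp add: d_def)
    moreover have "(-7/8 * log 2 (7/8) - 1/8 * log 2 (1/8)) + d
      \<le> - (7/8 - d) * log 2 (7/8 - d) - (1/8 + d) * log 2 (1/8 + d)"
      using d0 True by (intro binary_entropy_increment) auto
    ultimately have "\<epsilon> \<le> shannon_entropy n Q - shannon_entropy n P"
      unfolding P(3) Q(3) by (simp add: algebra_simps)
    then have gap: "\<epsilon> \<le> \<bar>shannon_entropy n P - shannon_entropy n Q\<bar>" by simp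
    have "1/200 < real m * (64 * d\<^sup>2)"
    proof (rule samples_needed_for_close_alternatives[OF dist P(1) Q(1) gap])
      have "(1/8 + d) / real (n - 1) \<le> (2 * (1/8)) / real (n - 1)"
        using True by (intro divide_right_mono) auto
      then have le1: "(1/8 + d) / real (n - 1) \<le> 2 * ((1/8) / real (n - 1))"
        by (simp only: times_divide_eq_right)
      have le2: "1 - (1/8 + d) \<le> 2 * (1 - 1/8)" using d0 by simp
      show "pmf Q x \<le> 2 * pmf P x" for x
        unfolding P(2) Q(2) by (cases "x = 1"; cases "x \<in> {2..n}")
          (simp_all only: if_True if_False mult_zero_right order_refl simp_thms le1 le2)
      show "(pmf Q x - pmf P x)\<^sup>2 \<le> 64 * d\<^sup>2 * pmf P x * pmf P x" for x
      proof -
        have "\<bar>pmf Q x - pmf P x\<bar> \<le> 8 * d * pmf P x"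
          unfolding P(2) Q(2) using d0 n by (auto simp: field_simps)
        then have "(pmf Q x - pmf P x)\<^sup>2 \<le> (8 * d * pmf P x)\<^sup>2"
          by (rule power2_le_iff_abs_le[THEN iffD2, rotated]) (use d0 in auto)
        then show ?thesis by (simp add: power2_eq_square mult_ac)
      qed
    qed simp
    then show ?thesis unfolding L using d0 by (simp add: field_simps)
  qed
qed

subsection \<open>Choice of parameters\<close>

text \<open>The reciprocal of 200 times the constant in \<open>chi_square_arith\<close>, so that the
  divergence bound becomes exactly 1/200.\<close>

definition collision_const :: real where
  "collision_const = 1 / (200 * (exp 32 * 10 ^ 12 * (100 * 24 ^ 3 + 24 ^ 2)))"

lemma collision_const: "0 < collision_const" "collision_const \<le> 1"
proof -
  show "0 < collision_const" by (simp add: collision_const_def)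
  have "1 \<le> exp (32::real)" by simp
  then have "1 * 1 \<le> exp (32::real) * (10 ^ 12 * (100 * 24 ^ 3 + 24 ^ 2))" by (intro mult_mono) auto
  then show "collision_const \<le> 1" by (simp add: collision_const_def)
qed

text \<open>At least half of the units are light, so the light rate \<open>L\<close> lies between
  \<open>500 * \<epsilon> * m\<close> and \<open>1000 * \<epsilon> * m\<close>. The total rate is at
  most \<open>(16 + 400 + 1000) * m\<close>, and \<open>3 * 500 \<ge> 1416\<close>; the 3 is
  \<open>log 2 8\<close>.\<close>

lemma entropy_gap_arith:
  fixes \<epsilon> h m r U :: real
  assumes m: "1 \<le> m" and U: "1 \<le> U" and \<epsilon>: "0 < \<epsilon>" "\<epsilon> \<le> 1"
    and h: "0 \<le> h" "h \<le> U / 2" "h \<le> 50 * m" and r: "8 * r = 1000 * \<epsilon> * m / U"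
  shows "\<epsilon> \<le> (U - h) * (8 * r / (16 * m + 8 * h + 8 * r * (U - h)) * 3)"
proof -
  define L where "L = 8 * r * (U - h)"
  have rU: "8 * r * U = 1000 * (\<epsilon> * m)" using U by (simp add: r)
  have r0: "0 \<le> 8 * r" using U m \<epsilon> by (simp add: r)
  have em: "0 < \<epsilon> * m" "\<epsilon> * m \<le> m" using m \<epsilon> by (auto intro: mult_left_le_one_le)
  have "8 * r * (U / 2) \<le> L" unfolding L_def using r0 h by (intro mult_left_mono) auto
  then have L1: "500 * (\<epsilon> * m) \<le> L" using rU by simp
  have "L \<le> 8 * r * U" unfolding L_def using r0 h by (intro mult_left_mono) auto
  then have L2: "L \<le> 1000 * (\<epsilon> * m)" using rU by simp
  have D: "0 < 16 * m + 8 * h + L" using m h L1 em by linarith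
  have "\<epsilon> * (16 * m + 8 * h + L) \<le> \<epsilon> * (1416 * m)"
    using h L2 em \<epsilon> by (intro mult_left_mono) auto
  also have "\<dots> \<le> 3 * L" using L1 em by linarith
  finally have "\<epsilon> \<le> 3 * L / (16 * m + 8 * h + L)" using D by (simp add: pos_le_divide_eq)
  then show ?thesis by (simp add: L_def mult_ac)
qed

text \<open>From \<open>1 / \<kappa> \<le> 100 + U / m\<close> the divergence splits into multiples
  of \<open>m^4 * \<epsilon>^4 / U^3\<close> and \<open>m^3 * \<epsilon>^4 / U^2\<close>, one for
  each term of the minimum. As \<open>c \<le> 1\<close>, both \<open>c^4\<close> and
  \<open>c^3\<close> are at most \<open>c\<close>.\<close>

lemma chi_square_arith:
  fixes \<epsilon> m r U \<kappa> n c :: real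
  assumes m: "1 \<le> m" and U: "1 \<le> U" and n: "0 \<le> n" "n \<le> 24 * U" and \<kappa>: "\<kappa> = min (1/100) (m / U)"
    and r: "8 * r = 1000 * \<epsilon> * m / U" and c: "0 < c" "c \<le> 1"
    and small: "m ^ 4 * \<epsilon> ^ 4 \<le> c ^ 4 * n ^ 3" "m ^ 3 * \<epsilon> ^ 4 \<le> c ^ 3 * n ^ 2"
  shows "U * ((exp 16 * (8 * r)\<^sup>2)\<^sup>2 / \<kappa>) \<le> c * (exp 32 * 10 ^ 12 * (100 * 24 ^ 3 + 24 ^ 2))"
proof -
  have \<kappa>0: "0 < \<kappa>" using m U by (simp add: \<kappa>)
  have "1 / \<kappa> \<le> 100 + U / m"
  proof (cases "1/100 \<le> m / U")
    case True
    then show ?thesis using m U by (simp add: \<kappa>)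
  next
    case False
    then show ?thesis using m U by (simp add: \<kappa> min_def)
  qed
  moreover define X where "X = (exp 16 * (8 * r)\<^sup>2)\<^sup>2"
  moreover have "0 \<le> U * X" using U by (simp add: X_def)
  ultimately have "U * X * (1 / \<kappa>) \<le> U * X * (100 + U / m)"
    by (intro mult_left_mono)
  also have "U * X * (100 + U / m) = U * (exp 32 * (10 ^ 12 * (\<epsilon> ^ 4 * m ^ 4 / U ^ 4))) * (100 + U / m)"
  proof -
    have "(exp (16::real))\<^sup>2 = exp 32" by (simp flip: exp_double)
    moreover have "((8 * r)\<^sup>2)\<^sup>2 = 10 ^ 12 * (\<epsilon> ^ 4 * m ^ 4 / U ^ 4)"
      unfolding r by (simp add: power_divide power_mult_distrib flip: power_mult)
    ultimately show ?thesis by (simp add: X_def power_mult_distrib)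
  qed
  also have "\<dots> = exp 32 * 10 ^ 12 * (100 * (m ^ 4 * \<epsilon> ^ 4 / U ^ 3) + m ^ 3 * \<epsilon> ^ 4 / U ^ 2)"
    using m U by (simp add: field_simps power2_eq_square power3_eq_cube power4_eq_xxxx)
  also have "\<dots> \<le> exp 32 * 10 ^ 12 * (100 * (c * 24 ^ 3) + c * 24 ^ 2)"
  proof -
    have "n ^ 3 \<le> (24 * U) ^ 3" "n ^ 2 \<le> (24 * U) ^ 2" using n by (intro power_mono; simp)+
    moreover have "c ^ 4 \<le> c" "c ^ 3 \<le> c" using c power_decreasing[of 1 4 c] power_decreasing[of 1 3 c] by auto
    ultimately have "c ^ 4 * n ^ 3 \<le> c * (24 * U) ^ 3" "c ^ 3 * n ^ 2 \<le> c * (24 * U) ^ 2"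
      using c n by (auto intro!: mult_mono)
    then have "m ^ 4 * \<epsilon> ^ 4 \<le> (c * 24 ^ 3) * U ^ 3" "m ^ 3 * \<epsilon> ^ 4 \<le> (c * 24 ^ 2) * U ^ 2"
      using small by (auto simp: power_mult_distrib)
    then have "m ^ 4 * \<epsilon> ^ 4 / U ^ 3 \<le> c * 24 ^ 3" "m ^ 3 * \<epsilon> ^ 4 / U ^ 2 \<le> c * 24 ^ 2"
      using U by (simp_all add: pos_divide_le_eq)
    then show ?thesis by (intro mult_left_mono add_mono) auto
  qed
  finally have "U * X * (1 / \<kappa>) \<le> exp 32 * 10 ^ 12 * (100 * (c * 24 ^ 3) + c * 24 ^ 2)" .
  then show ?thesis unfolding X_def[symmetric] by (simp add: mult_ac)
qed

lemma collision_lower_bound_min: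
  fixes \<epsilon> :: real
  assumes n: "16 \<le> n" and \<epsilon>: "0 < \<epsilon>" "\<epsilon> \<le> 1" and dist: "distinguishes A m n \<epsilon>"
  shows "collision_const * min (real n powr (3/4) / \<epsilon>) (real n powr (2/3) / \<epsilon> powr (4/3)) \<le> real m"
proof (rule ccontr)
  define c where "c = collision_const"
  have c: "0 < c" "c \<le> 1" using collision_const by (auto simp: c_def)
  assume "\<not> ?thesis"
  then have lt: "real m < c * min (real n powr (3/4) / \<epsilon>) (real n powr (2/3) / \<epsilon> powr (4/3))"
    by (simp add: c_def)
  also have "\<dots> \<le> c * (real n powr (3/4) / \<epsilon>)" using c by (intro mult_left_mono min.cobounded1) auto
  finally have m1: "real m * \<epsilon> \<le> c * real n powr (3/4)" using \<epsilon> by (simp add: field_simps)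
  note lt
  also have "c * min (real n powr (3/4) / \<epsilon>) (real n powr (2/3) / \<epsilon> powr (4/3))
      \<le> c * (real n powr (2/3) / \<epsilon> powr (4/3))" using c by (intro mult_left_mono min.cobounded2) auto
  finally have m2: "real m * \<epsilon> powr (4/3) \<le> c * real n powr (2/3)" using \<epsilon> by (simp add: field_simps)
  have n0: "0 < real n" using n by simp
  \<comment> \<open>Fourth and third powers clear the fractional exponents of the two terms.\<close>
  have "(real m * \<epsilon>) ^ 4 \<le> (c * real n powr (3/4)) ^ 4" using m1 \<epsilon> by (intro power_mono) auto
  moreover have "(real n powr (3/4)) ^ 4 = real n ^ 3"
    using n0 by (simp add: powr_power)
  ultimately have s1: "real m ^ 4 * \<epsilon> ^ 4 \<le> c ^ 4 * real n ^ 3" by (simp add: power_mult_distrib)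
  have "(real m * \<epsilon> powr (4/3)) ^ 3 \<le> (c * real n powr (2/3)) ^ 3" using m2 \<epsilon> by (intro power_mono) auto
  moreover have "(real n powr (2/3)) ^ 3 = real n ^ 2"
    using n0 by (simp add: powr_power)
  moreover have "(\<epsilon> powr (4/3)) ^ 3 = \<epsilon> ^ 4"
    using \<epsilon> by (simp add: powr_power)
  ultimately have s2: "real m ^ 3 * \<epsilon> ^ 4 \<le> c ^ 3 * real n ^ 2" by (simp add: power_mult_distrib)
  have m: "1 \<le> m" using at_least_one_sample[OF _ \<epsilon>(2) dist] n by simp
  \<comment> \<open>Units have 8 elements and one of them is the reserve; \<open>16 \<le> n\<close>
    leaves at least one other.\<close>
  define U where "U = n div 8 - 1"
  have U: "1 \<le> U" "8 * (U + 1) \<le> n" "n \<le> 24 * U"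
  proof -
    define k where "k = n div 8"
    have "2 \<le> k" "8 * k \<le> n" "n \<le> 8 * k + 7" using n by (auto simp: k_def)
    then show "1 \<le> U" "8 * (U + 1) \<le> n" "n \<le> 24 * U" by (simp_all add: U_def flip: k_def)
  qed
  \<comment> \<open>The cap 1/100 keeps \<open>50 * \<kappa> * U\<close> below half of the units,
    the cap \<open>m / U\<close> keeps it below \<open>50 * m\<close>.\<close>
  define \<kappa> where "\<kappa> = min (1/100) (real m / real U)"
  define r where "r = 125 * \<epsilon> * real m / real U"
  have r: "8 * r = 1000 * \<epsilon> * real m / real U" by (simp add: r_def)
  have r0: "0 < r" using \<epsilon> m U by (simp add: r_def)
  have \<kappa>: "0 < \<kappa>" "\<kappa> \<le> 1" "\<kappa> * real U \<le> real U / 100" "\<kappa> * real U \<le> real m"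
  proof -
    show "0 < \<kappa>" "\<kappa> \<le> 1" using m U by (auto simp: \<kappa>_def)
    have "\<kappa> * real U \<le> 1/100 * real U" "\<kappa> * real U \<le> real m / real U * real U"
      unfolding \<kappa>_def by (intro mult_right_mono min.cobounded1 min.cobounded2 of_nat_0_le_iff)+
    then show "\<kappa> * real U \<le> real U / 100" "\<kappa> * real U \<le> real m" using U by auto
  qed
  have chi: "real U * ((exp 16 * (8 * r)\<^sup>2)\<^sup>2 / \<kappa>) \<le> 1/200"
  proof -
    have "real U * ((exp 16 * (8 * r)\<^sup>2)\<^sup>2 / \<kappa>) \<le> c * (exp 32 * 10 ^ 12 * (100 * 24 ^ 3 + 24 ^ 2))"
      using U m by (intro chi_square_arith[OF _ _ _ _ \<kappa>_def r c s1 s2]) auto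
    also have "\<dots> = 1/200" by (simp add: c_def collision_const_def)
    finally show ?thesis .
  qed
  \<comment> \<open>Otherwise the divergence bound itself would be at least 1, as
    \<open>exp 16 \<ge> 1\<close>, \<open>U \<ge> 1\<close> and
    \<open>\<kappa> \<le> 1\<close>.\<close>
  have r8: "8 * r \<le> 1"
  proof (rule ccontr)
    assume "\<not> 8 * r \<le> 1"
    then have "1 \<le> (8 * r)\<^sup>2" by (intro one_le_power) auto
    then have "1 * 1 \<le> exp 16 * (8 * r)\<^sup>2" by (intro mult_mono) auto
    then have "1 \<le> (exp 16 * (8 * r)\<^sup>2)\<^sup>2" by (intro one_le_power) auto
    then have "\<kappa> \<le> (exp 16 * (8 * r)\<^sup>2)\<^sup>2" using \<kappa>(2) by linarith
    then have "1 \<le> (exp 16 * (8 * r)\<^sup>2)\<^sup>2 / \<kappa>" using \<kappa>(1) by simp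
    then have "1 * 1 \<le> real U * ((exp 16 * (8 * r)\<^sup>2)\<^sup>2 / \<kappa>)" using U by (intro mult_mono) auto
    then show False using chi by linarith
  qed
  show False
  proof (rule collision_lower_bound[OF dist m U(1) _ U(2) \<kappa>(1,2) r0, where \<mu> = "2 * real m"])
    fix h assume h: "0 \<le> h" "h \<le> 50 * (\<kappa> * real U)" "h \<le> real U"
    have "h \<le> real U / 2" "h \<le> 50 * real m" using h(2) \<kappa>(3,4) by linarith+
    then have "\<epsilon> \<le> (real U - h) * (8 * r / (16 * real m + 8 * h + 8 * r * (real U - h)) * 3)"
      using U m h(1) by (intro entropy_gap_arith[OF _ _ \<epsilon> _ _ _ r]) simp_all
    moreover have "log 2 (real (8::nat)) = 3"
      using log_pow_cancel[of "2::real" 3] by simp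
    ultimately show "\<epsilon> \<le> (real U - h) * (real 8 * r / (real 8 * (2 * real m) + real 8 * h + real 8 * r * (real U - h))
        * log 2 (real 8))"
      by simp
  qed (use r8 chi in auto)
qed

section \<open>Combination of the two bounds\<close>

theorem theorem4p2:
  "\<exists>c1>0. \<exists>c2>0. \<exists>k::nat. \<forall>n::nat. \<forall>\<epsilon>::real. n \<ge> 2 \<longrightarrow> 0 < \<epsilon> \<longrightarrow> \<epsilon> \<le> 1 \<longrightarrow>
     (\<forall>(A :: nat list \<Rightarrow> nat list \<Rightarrow> bool pmf) (m::nat). distinguishes A m n \<epsilon> \<longrightarrow>
        (let M = min (real n powr (3/4) / \<epsilon>) (real n powr (2/3) / \<epsilon> powr (4/3))
         in real m \<ge> c1 * (M / log 2 M ^ k) + c2 * ((log 2 (real n))\<^sup>2 / \<epsilon>\<^sup>2)))"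
proof -
  define c where "c = min collision_const (1/12800/15)"
  have c: "0 < c" "c \<le> collision_const" "c \<le> 1/12800/15" using collision_const by (auto simp: c_def)
  \<comment> \<open>Each term is bounded by \<open>m\<close> separately, so half of each gives the
    sum.\<close>
  have main: "c/2 * (M / log 2 M ^ 0) + 1/25600 * ((log 2 (real n))\<^sup>2 / \<epsilon>\<^sup>2) \<le> real m"
    if n: "2 \<le> n" and \<epsilon>: "0 < \<epsilon>" "\<epsilon> \<le> 1" and dist: "distinguishes A m n \<epsilon>"
      and M: "M = min (real n powr (3/4) / \<epsilon>) (real n powr (2/3) / \<epsilon> powr (4/3))"
    for n m :: nat and \<epsilon> M :: real and A
  proof -
    have two: "1/12800 * ((log 2 (real n))\<^sup>2 / \<epsilon>\<^sup>2) \<le> real m"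
      by (rule two_point_lower_bound[OF n \<epsilon> dist])
    have M0: "0 \<le> M" using \<epsilon> by (simp add: M)
    have "c * M \<le> real m"
    proof (cases "16 \<le> n")
      case True
      have "c * M \<le> collision_const * M" using c M0 by (intro mult_right_mono) auto
      also have "\<dots> \<le> real m" unfolding M by (rule collision_lower_bound_min[OF True \<epsilon> dist])
      finally show ?thesis .
    next
      \<comment> \<open>For \<open>n < 16\<close>, \<open>M \<le> 15 / \<epsilon> \<le> 15 * (log 2
        n)^2 / \<epsilon>^2\<close>, so the two-point bound covers this term; hence the 15 in the
        choice of \<open>c\<close>.\<close>
      case False
      have "real n powr (3/4) \<le> real n powr 1" using n by (intro powr_mono) auto
      then have "real n powr (3/4) \<le> 15" using False by simp
      then have "M \<le> 15 / \<epsilon>" using \<epsilon> by (auto simp: M min_le_iff_disj intro!: divide_right_mono)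
      also have "\<dots> \<le> 15 / \<epsilon>\<^sup>2"
        using \<epsilon> power_decreasing[of 1 2 \<epsilon>] by (intro divide_left_mono) auto
      also have "\<dots> \<le> 15 * (log 2 (real n))\<^sup>2 / \<epsilon>\<^sup>2"
        using n by (intro divide_right_mono) (auto simp: le_log_iff intro!: one_le_power)
      finally have "c * M \<le> (1/12800/15) * (15 * (log 2 (real n))\<^sup>2 / \<epsilon>\<^sup>2)"
        using c M0 by (intro mult_mono) auto
      then show ?thesis using two by simp
    qed
    then show ?thesis using two by simp
  qed
  show ?thesis
    unfolding Let_def
    by (rule exI[of _ "c/2"], rule conjI, use c in simp, rule exI[of _ "1/25600"], rule conjI, simp,
        rule exI[of _ 0], intro allI impI, rule main) auto
qed

end
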